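(* Let $(R,\mathfrak m)$ be a regular local ring of dimension $n$, $f\in R$ a non-unit with $m=\operatorname{ord}_{\mathfrak m}(f)>1$, $R'=R/\langle f\rangle$ with maximal ideal $\mathfrak m'$, and suppose $R'$ is in the extremal case. Let $u_1,\dots,u_{n-1},y_1\in R$ be a regular system of parameters of $R$ with $\operatorname{In}_{\mathfrak m}(f)=\operatorname{In}_{\mathfrak m}(y_1)^m$. Then $\bar\nu_{\mathfrak m'}(y'_1)=\delta(\Delta(f,u,y_1))$, where $y'_1$ is the class of $y_1$ in $R'$.
   Context: $\bar\nu_{\mathfrak m'}(a)=\lim_k\nu_{\mathfrak m'}(a^k)/k$, $\nu_{\mathfrak m'}(b)=\sup\{s:b\in\mathfrak m'^s\}$. With $\lambda_{\mathfrak m'}:\mathfrak m'/\mathfrak m'^2\to\{\bar\nu_{\mathfrak m'}\ge1\}/\{\bar\nu_{\mathfrak m'}>1\}$ the natural map and $t=\dim(\mathfrak m'/\mathfrak m'^2)-\dim R'>0$, $R'$ is in the extremal case if $\dim\ker\lambda_{\mathfrak m'}=t$. CP-expansion w.r.t. $(u,y_1)$: unique finite $S(f)\subset\mathbb N^{n-1}\times\mathbb N$ with $\{u^\alpha y_1^i\}_{(\alpha,i)\in S(f)}$ minimally generating the ideal it generates and units $c_{\alpha,i}$ with $f=\sum c_{\alpha,i}u^\alpha y_1^i$. Hironaka's polyhedron: $\Delta(f,u,y_1)=\operatorname{Conv}(\{\alpha/(m-i):(\alpha,i)\in S(f),i<m\}+\mathbb N^{n-1})\subset\mathbb R^{n-1}$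 and $\delta(P)=\min\{|\gamma|:\gamma\in P\}$ (with value $\infty$ for the empty set), $|\gamma|$ the sum of coordinates. *)

theory Defs
  imports "HOL-Algebra.Algebra" "HOL-Library.Extended_Real" Complex_Main
begin

primrec ideal_pow :: "('a, 'b) ring_scheme \<Rightarrow> 'a set \<Rightarrow> nat \<Rightarrow> 'a set" where
  "ideal_pow R M 0 = carrier R"
| "ideal_pow R M (Suc s) = ideal_prod R (ideal_pow R M s) M"

definition noetherian_ring :: "('a, 'b) ring_scheme \<Rightarrow> bool" where
  "noetherian_ring R \<longleftrightarrow> cring R \<and>
     (\<forall>I. ideal I R \<longrightarrow> (\<exists>G. finite G \<and> G \<subseteq> carrier R \<and> I = Idl\<^bsub>R\<^esub> G))"

definition local_ring :: "('a, 'b) ring_scheme \<Rightarrow> bool" where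
  "local_ring R \<longleftrightarrow> cring R \<and> (\<exists>!M. maximalideal M R)"

definition max_ideal :: "('a, 'b) ring_scheme \<Rightarrow> 'a set" where
  "max_ideal R = (THE M. maximalideal M R)"

definition krull_dim :: "('a, 'b) ring_scheme \<Rightarrow> enat" where
  "krull_dim R = (SUP Ps \<in> {Ps :: 'a set list. Ps \<noteq> [] \<and> (\<forall>P\<in>set Ps. primeideal P R) \<and>
                      (\<forall>i. Suc i < length Ps \<longrightarrow> Ps ! i \<subset> Ps ! Suc i)}.
                   enat (length Ps - 1))"

definition regular_local_ring :: "('a, 'b) ring_scheme \<Rightarrow> nat \<Rightarrow> bool" where
  "regular_local_ring R n \<longleftrightarrow> noetherian_ring R \<and> local_ring R \<and> krull_dim R = enat n \<and>
     (\<exists>G. G \<subseteq> carrier R \<and> finite G \<and> card G \<le> n \<and> max_ideal R = Idl\<^bsub>R\<^esub> G)"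

definition regular_system_of_parameters :: "('a, 'b) ring_scheme \<Rightarrow> nat \<Rightarrow> 'a list \<Rightarrow> bool" where
  "regular_system_of_parameters R n xs \<longleftrightarrow> regular_local_ring R n \<and> length xs = n \<and>
     set xs \<subseteq> carrier R \<and> max_ideal R = Idl\<^bsub>R\<^esub> (set xs)"

definition ord_ideal :: "('a, 'b) ring_scheme \<Rightarrow> 'a set \<Rightarrow> 'a \<Rightarrow> ereal" where
  "ord_ideal R M b = (SUP s \<in> {s. b \<in> ideal_pow R M s}. ereal (real s))"

definition asym_ord :: "('a, 'b) ring_scheme \<Rightarrow> 'a set \<Rightarrow> 'a \<Rightarrow> ereal" where
  "asym_ord R M a = lim (\<lambda>k. ord_ideal R M (a [^]\<^bsub>R\<^esub> (Suc k)) / ereal (real (Suc k)))"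

text \<open>Elements xs of M whose classes in M/M^2 are linearly independent over the residue
  field A/M: any A-linear combination lying in M^2 has all coefficients in M.\<close>
definition lin_indep_mod_sq :: "('a, 'b) ring_scheme \<Rightarrow> 'a set \<Rightarrow> 'a list \<Rightarrow> bool" where
  "lin_indep_mod_sq A M xs \<longleftrightarrow> set xs \<subseteq> M \<and>
     (\<forall>r. (\<forall>i<length xs. r i \<in> carrier A) \<longrightarrow>
          (\<Oplus>\<^bsub>A\<^esub> i\<in>{..<length xs}. r i \<otimes>\<^bsub>A\<^esub> xs ! i) \<in> ideal_pow A M 2 \<longrightarrow>
          (\<forall>i<length xs. r i \<in> M))"

text \<open>Dimension over A/M of the image of K \<subseteq> M in M/M^2 (of the subspace it spans).\<close>
definition dim_mod_sq :: "('a, 'b) ring_scheme \<Rightarrow> 'a set \<Rightarrow> 'a set \<Rightarrow> enat" where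
  "dim_mod_sq A M K = (SUP xs \<in> {xs. set xs \<subseteq> K \<and> lin_indep_mod_sq A M xs}. enat (length xs))"

text \<open>Kernel of lambda_M : M/M^2 \<rightarrow> {nubar \<ge> 1}/{nubar > 1}, x + M^2 \<mapsto> x + {nubar > 1}:
  it is the image in M/M^2 of {x \<in> M. nubar_M(x) > 1}.\<close>
definition ker_lambda_set :: "('a, 'b) ring_scheme \<Rightarrow> 'a set" where
  "ker_lambda_set A = {x \<in> max_ideal A. asym_ord A (max_ideal A) x > 1}"

definition extremal_case :: "('a, 'b) ring_scheme \<Rightarrow> bool" where
  "extremal_case A \<longleftrightarrow>
     (\<exists>e d t. dim_mod_sq A (max_ideal A) (max_ideal A) = enat e \<and> krull_dim A = enat d \<and>
        t = int e - int d \<and> t > 0 \<and>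
        dim_mod_sq A (max_ideal A) (ker_lambda_set A) = enat (nat t))"

text \<open>Exponent vectors alpha \<in> N^(n-1) are functions nat \<Rightarrow> nat supported in {..<n-1}.\<close>
definition exps :: "nat \<Rightarrow> (nat \<Rightarrow> nat) set" where
  "exps k = {\<alpha>. \<forall>j\<ge>k. \<alpha> j = 0}"

definition cp_monom :: "('a, 'b) ring_scheme \<Rightarrow> 'a list \<Rightarrow> 'a \<Rightarrow> (nat \<Rightarrow> nat) \<Rightarrow> nat \<Rightarrow> 'a" where
  "cp_monom R u y \<alpha> i = (\<Otimes>\<^bsub>R\<^esub> j\<in>{..<length u}. (u ! j) [^]\<^bsub>R\<^esub> \<alpha> j) \<otimes>\<^bsub>R\<^esub> (y [^]\<^bsub>R\<^esub> i)"

definition CP_expansion :: "('a, 'b) ring_scheme \<Rightarrow> 'a list \<Rightarrow> 'a \<Rightarrow> 'a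
      \<Rightarrow> ((nat \<Rightarrow> nat) \<times> nat) set \<Rightarrow> ((nat \<Rightarrow> nat) \<times> nat \<Rightarrow> 'a) \<Rightarrow> bool" where
  "CP_expansion R u y f S c \<longleftrightarrow> finite S \<and> fst ` S \<subseteq> exps (length u) \<and>
     (\<forall>p\<in>S. cp_monom R u y (fst p) (snd p) \<notin>
         Idl\<^bsub>R\<^esub> ((\<lambda>q. cp_monom R u y (fst q) (snd q)) ` (S - {p}))) \<and>
     (\<forall>p\<in>S. c p \<in> Units R) \<and>
     f = (\<Oplus>\<^bsub>R\<^esub> p\<in>S. c p \<otimes>\<^bsub>R\<^esub> cp_monom R u y (fst p) (snd p))"

text \<open>Convex hull in R^k (points nat \<Rightarrow> real supported in {..<k}) as the set of finite
  convex combinations.\<close>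
definition conv_hull :: "(nat \<Rightarrow> real) set \<Rightarrow> (nat \<Rightarrow> real) set" where
  "conv_hull Xs = {gam. \<exists>(J::nat set) wt pt. finite J \<and> J \<noteq> {} \<and> (\<forall>j\<in>J. wt j \<ge> 0 \<and> pt j \<in> Xs) \<and>
                      (\<Sum>j\<in>J. wt j) = (1::real) \<and> gam = (\<lambda>l::nat. \<Sum>j\<in>J. wt j * pt j l)}"

text \<open>Hironaka's polyhedron Delta(f,u,y) \<subseteq> R^k (k = length u) from the set S(f),
  with m the order of f.\<close>
definition hironaka_poly :: "nat \<Rightarrow> nat \<Rightarrow> ((nat \<Rightarrow> nat) \<times> nat) set \<Rightarrow> (nat \<Rightarrow> real) set" where
  "hironaka_poly k m S = conv_hull
     {\<gamma>. \<exists>\<alpha> i \<beta>. (\<alpha>, i) \<in> S \<and> i < m \<and> \<beta> \<in> exps k \<and>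
          \<gamma> = (\<lambda>l. real (\<alpha> l) / real (m - i) + real (\<beta> l))}"

text \<open>delta(P) = min { |gamma| : gamma \<in> P } (infinity for P empty).\<close>
definition delta_poly :: "nat \<Rightarrow> (nat \<Rightarrow> real) set \<Rightarrow> ereal" where
  "delta_poly k P = Inf ((\<lambda>\<gamma>. ereal (\<Sum>l<k. \<gamma> l)) ` P)"

end

theory Submission
  imports Defs
begin

text \<open>Give \<open>u\<^sub>1, \<dots>, u\<^sub>n\<^sub>-\<^sub>1\<close> weight \<open>q\<close> and \<open>y\<close> weight \<open>p\<close>, where \<open>\<delta> = p/q = |\<alpha>|/(m - i)\<close> is the minimal slope over
  the exponents \<open>(\<alpha>, i)\<close> of \<open>f\<close> with \<open>i < m\<close>; then all exponents of \<open>f\<close> have weight at least that of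
  \<open>y\<^sup>m\<close>. Dividing by \<open>f\<close>, \<open>y\<^sup>k\<close> becomes a combination of monomials of at least the same weight with
  \<open>y\<close>-degree below \<open>m\<close>, so the order of \<open>y'\<^sup>k\<close> is at least \<open>k\<delta>\<close> up to a bounded error.

  Conversely let \<open>y\<^sup>k = g + h f\<close> with \<open>g \<in> \<mm>\<^sup>s\<close> and \<open>s > k\<delta>\<close>. Perturb the weights so that distinct
  (small) monomials have distinct weights and \<open>f\<close> acquires an initial monomial divisible by some \<open>u\<^sub>j\<close>.
  Then \<open>y\<^sup>k\<close> is also the initial monomial of \<open>h f\<close>, hence divisible by that of \<open>f\<close>, a contradiction.

  That a monomial never lies in the ideal of the monomials of larger weight is where regularity
  enters: otherwise, for \<open>L\<close> a common multiple of the weights \<open>N\<^sub>j\<close>, the maximal ideal would be minimal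
  over the \<open>n - 1\<close> differences \<open>x\<^sub>j ^ (L/N\<^sub>j) - x\<^sub>n ^ (L/N\<^sub>n)\<close>, against Krull's height theorem.\<close>

section \<open>Krull's height theorem\<close>

locale noetherian_cring = noetherian_ring + cring

section \<open>Sums with a principal ideal, and ideals contracted from a localization\<close>

context cring
begin

lemma mem_add_cgenideal_iff:
  assumes "ideal I R" "z \<in> carrier R"
  shows "a \<in> I <+>\<^bsub>R\<^esub> PIdl z \<longleftrightarrow> (\<exists>i\<in>I. \<exists>r\<in>carrier R. a = i \<oplus> r \<otimes> z)"
  by (auto simp: set_add_def' cgenideal_def)

lemma ideal_add_cgenideal:
  assumes "ideal I R" "z \<in> carrier R"
  shows "ideal (I <+>\<^bsub>R\<^esub> PIdl z) R" "I \<subseteq> I <+>\<^bsub>R\<^esub> PIdl z" "z \<in> I <+>\<^bsub>R\<^esub> PIdl z"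
proof -
  interpret ideal I R by fact
  show "ideal (I <+>\<^bsub>R\<^esub> PIdl z) R" using add_ideals assms cgenideal_ideal by blast
  show "I \<subseteq> I <+>\<^bsub>R\<^esub> PIdl z"
  proof
    fix a assume "a \<in> I"
    then show "a \<in> I <+>\<^bsub>R\<^esub> PIdl z"
      unfolding mem_add_cgenideal_iff[OF assms]
      by (intro bexI[of _ a] bexI[of _ \<zero>]) (use assms Icarr in auto)
  qed
  show "z \<in> I <+>\<^bsub>R\<^esub> PIdl z"
    unfolding mem_add_cgenideal_iff[OF assms]
    by (intro bexI[of _ \<zero>] bexI[of _ \<one>]) (use assms in auto)
qed

lemma add_cgenideal_subset:
  assumes "ideal I R" "z \<in> K" "ideal K R" "I \<subseteq> K"
  shows "I <+>\<^bsub>R\<^esub> PIdl z \<subseteq> K"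
proof
  interpret K: ideal K R by fact
  fix a assume "a \<in> I <+>\<^bsub>R\<^esub> PIdl z"
  then obtain i r where "i \<in> I" "r \<in> carrier R" "a = i \<oplus> r \<otimes> z"
    using mem_add_cgenideal_iff[OF assms(1)] assms(2) K.Icarr by blast
  then show "a \<in> K" using assms(2,4) by (simp add: K.I_l_closed subset_iff)
qed

lemma set_add_cgenideal_mono:
  assumes "I \<subseteq> J" shows "I <+>\<^bsub>R\<^esub> PIdl z \<subseteq> J <+>\<^bsub>R\<^esub> PIdl z"
  using assms by (fastforce simp: set_add_def')

text \<open>For \<open>P\<close> prime this is the contraction to \<open>R\<close> of the extension
  of \<open>I\<close> to the localization at \<open>P\<close>. Working with contractions keeps every
  argument about the local ring inside \<open>R\<close>.\<close>

definition sat :: "'a set \<Rightarrow> 'a set \<Rightarrow> 'a set" where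
  "sat P I = {a \<in> carrier R. \<exists>s \<in> carrier R - P. s \<otimes> a \<in> I}"

text \<open>For \<open>P\<close> prime, the ideals with this property correspond to the ideals of
  the localization at \<open>P\<close>.\<close>

definition saturated :: "'a set \<Rightarrow> 'a set \<Rightarrow> bool" where
  "saturated P I \<longleftrightarrow> (\<forall>s\<in>carrier R - P. \<forall>a\<in>carrier R. s \<otimes> a \<in> I \<longrightarrow> a \<in> I)"

lemma saturatedD:
  assumes "saturated P I" "s \<otimes> a \<in> I" "s \<in> carrier R" "s \<notin> P" "a \<in> carrier R"
  shows "a \<in> I"
  using assms unfolding saturated_def by blast

lemma primeideal_notin_mult:
  assumes "primeideal P R" "a \<in> carrier R - P" "b \<in> carrier R - P"
  shows "a \<otimes> b \<in> carrier R - P"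
  using assms primeideal.I_prime by fastforce

lemma primeideal_one_notin: "primeideal P R \<Longrightarrow> \<one> \<notin> P"
  using ideal.one_imp_carrier primeideal.I_notcarr primeideal.axioms(1) by blast

lemma ideal_sat:
  assumes P: "primeideal P R" and I: "ideal I R"
  shows "ideal (sat P I) R"
proof -
  interpret P: primeideal P R by fact
  interpret I: ideal I R by fact
  show ?thesis
  proof (rule idealI)
    show "ring R" by (rule ring_axioms)
    show "subgroup (sat P I) (add_monoid R)"
    proof (rule add.subgroupI)
      show "sat P I \<subseteq> carrier R" by (auto simp: sat_def)
      have "\<one> \<otimes> \<zero> \<in> I" "\<one> \<in> carrier R - P" using P primeideal_one_notin by auto
      then have "\<zero> \<in> sat P I" unfolding sat_def by blast
      then show "sat P I \<noteq> {}" by blast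
      show "\<ominus> a \<in> sat P I" if "a \<in> sat P I" for a
        using that unfolding sat_def by (auto simp: r_minus)
      fix a b assume "a \<in> sat P I" "b \<in> sat P I"
      then obtain s t where *: "a \<in> carrier R" "b \<in> carrier R" "s \<in> carrier R - P" "t \<in> carrier R - P"
        "s \<otimes> a \<in> I" "t \<otimes> b \<in> I" unfolding sat_def by blast
      have "(s \<otimes> t) \<otimes> (a \<oplus> b) = t \<otimes> (s \<otimes> a) \<oplus> s \<otimes> (t \<otimes> b)"
        using * by simp algebra
      also have "\<dots> \<in> I" using * by (simp add: I.I_l_closed)
      finally show "a \<oplus> b \<in> sat P I"
        unfolding sat_def using primeideal_notin_mult[OF P *(3,4)] * by auto
    qed
    fix a x assume "a \<in> sat P I" and x: "x \<in> carrier R"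
    then obtain s where *: "a \<in> carrier R" "s \<in> carrier R - P" "s \<otimes> a \<in> I" unfolding sat_def by blast
    have "s \<otimes> (x \<otimes> a) = x \<otimes> (s \<otimes> a)" using * x by simp algebra
    also have "\<dots> \<in> I" using * x by (simp add: I.I_l_closed)
    finally show 1: "x \<otimes> a \<in> sat P I" unfolding sat_def using * x by auto
    then show "a \<otimes> x \<in> sat P I" using * x m_comm by simp
  qed
qed

lemma subset_sat:
  assumes "primeideal P R" "ideal I R" shows "I \<subseteq> sat P I"
proof
  fix a assume "a \<in> I"
  then have "a \<in> carrier R" "\<one> \<otimes> a \<in> I" using assms(2) ideal.Icarr by fastforce+
  then show "a \<in> sat P I" unfolding sat_def using primeideal_one_notin[OF assms(1)] by blast
qed

lemma sat_mono: "I \<subseteq> J \<Longrightarrow> sat P I \<subseteq> sat P J"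
  unfolding sat_def by blast

lemma saturated_sat:
  assumes "primeideal P R" "ideal I R" shows "saturated P (sat P I)"
  unfolding saturated_def
proof (intro ballI impI)
  fix s a assume s: "s \<in> carrier R - P" and a: "a \<in> carrier R" "s \<otimes> a \<in> sat P I"
  then obtain t where t: "t \<in> carrier R - P" "t \<otimes> (s \<otimes> a) \<in> I" unfolding sat_def by blast
  then have "(t \<otimes> s) \<otimes> a \<in> I" using s a by (simp add: m_assoc)
  then show "a \<in> sat P I" unfolding sat_def using primeideal_notin_mult[OF assms(1) t(1) s] a by blast
qed

lemma sat_subset:
  assumes "saturated P J" "I \<subseteq> J" shows "sat P I \<subseteq> J"
  using assms unfolding sat_def saturated_def by blast

lemma ideal_colon:
  assumes I: "ideal I R" and g: "g \<in> carrier R"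
  shows "ideal {a \<in> carrier R. a \<otimes> g \<in> I} R"
proof -
  interpret I: ideal I R by fact
  show ?thesis
  proof (rule idealI)
    show "ring R" by (rule ring_axioms)
    show "subgroup {a \<in> carrier R. a \<otimes> g \<in> I} (add_monoid R)"
      by (rule add.subgroupI) (use g in \<open>auto simp: l_minus l_distr intro!: exI[of _ \<zero>]\<close>)
    fix a x assume a: "a \<in> {a \<in> carrier R. a \<otimes> g \<in> I}" and x: "x \<in> carrier R"
    then have "x \<otimes> (a \<otimes> g) \<in> I" by (simp add: I.I_l_closed)
    then show 1: "x \<otimes> a \<in> {a \<in> carrier R. a \<otimes> g \<in> I}" using a x g by (simp add: m_assoc)
    then show "a \<otimes> x \<in> {a \<in> carrier R. a \<otimes> g \<in> I}" using a x by (simp add: m_comm)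
  qed
qed

end

section \<open>Descending chains of saturated ideals and the principal ideal theorem\<close>

context noetherian_cring
begin

text \<open>In a Noetherian ring the union of a nonempty chain of ideals belongs to the chain, so
  Zorn's lemma applies to any nonempty family of ideals.\<close>

lemma obtain_maximal_ideal_in:
  assumes "F \<noteq> {}" "\<And>I. I \<in> F \<Longrightarrow> ideal I R"
  obtains K where "K \<in> F" "\<And>J. J \<in> F \<Longrightarrow> K \<subseteq> J \<Longrightarrow> J = K"
proof -
  have "\<exists>M\<in>F. \<forall>Y\<in>F. M \<subseteq> Y \<longrightarrow> Y = M"
  proof (rule subset_Zorn_nonempty[OF assms(1)])
    fix C assume C: "C \<noteq> {}" "subset.chain F C"
    then have "subset.chain {I. ideal I R} C"
      using assms(2) unfolding pred_on.chain_def by auto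
    then have "\<Union>C \<in> C" using ideal_chain_is_trivial[OF C(1)] by simp
    moreover have "C \<subseteq> F" using C(2) unfolding pred_on.chain_def by simp
    ultimately show "\<Union>C \<in> F" by (rule subsetD[rotated])
  qed
  then obtain K where "K \<in> F" "\<forall>Y\<in>F. K \<subseteq> Y \<longrightarrow> Y = K" by (rule bexE)
  then show ?thesis by (intro that[of K]) simp_all
qed

text \<open>Stands in for: the localization at \<open>P\<close> is Artinian modulo \<open>I\<close>.\<close>
definition sat_dcc :: "'a set \<Rightarrow> 'a set \<Rightarrow> bool" where
  "sat_dcc P I \<longleftrightarrow> (\<forall>J :: nat \<Rightarrow> 'a set.
     (\<forall>n. ideal (J n) R \<and> saturated P (J n) \<and> I \<subseteq> J n \<and> J (Suc n) \<subseteq> J n) \<longrightarrow>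
     (\<exists>N. \<forall>n\<ge>N. J n = J N))"

text \<open>Among the colon ideals of elements \<open>g\<close> outside \<open>I\<close> a maximal
  one is prime: if \<open>b \<otimes> g\<close> is still outside \<open>I\<close>, its colon ideal
  contains that of \<open>g\<close> and hence equals it.\<close>

lemma associated_prime:
  assumes I: "ideal I R" and ne: "I \<noteq> carrier R"
  obtains g where "g \<in> carrier R" "g \<notin> I" "primeideal {a \<in> carrier R. a \<otimes> g \<in> I} R"
proof -
  interpret I: ideal I R by fact
  define F where "F = (\<lambda>g. {a \<in> carrier R. a \<otimes> g \<in> I}) ` (carrier R - I)"
  have "F \<noteq> {}" using ne I.a_subset unfolding F_def by blast
  moreover have "ideal J R" if "J \<in> F" for J using that ideal_colon[OF I] unfolding F_def by auto
  ultimately obtain K where K: "K \<in> F" "\<And>J. J \<in> F \<Longrightarrow> K \<subseteq> J \<Longrightarrow> J = K"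
    using obtain_maximal_ideal_in by blast
  then obtain g where g: "g \<in> carrier R" "g \<notin> I" "K = {a \<in> carrier R. a \<otimes> g \<in> I}"
    unfolding F_def by auto
  have "primeideal K R"
  proof (rule primeidealI)
    show "ideal K R" using g ideal_colon[OF I] by auto
    show "cring R" by (rule is_cring)
    have "\<one> \<notin> K" using g by simp
    then show "carrier R \<noteq> K" by auto
    fix a b assume a: "a \<in> carrier R" and b: "b \<in> carrier R" and ab: "a \<otimes> b \<in> K"
    show "a \<in> K \<or> b \<in> K"
    proof (rule disjCI)
      assume "b \<notin> K"
      then have bg: "b \<otimes> g \<in> carrier R - I" using b g by auto
      have "K \<subseteq> {a \<in> carrier R. a \<otimes> (b \<otimes> g) \<in> I}"
      proof
        fix c assume "c \<in> K"
        then have "c \<in> carrier R" "b \<otimes> (c \<otimes> g) \<in> I" using g b by (auto simp: I.I_l_closed)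
        then show "c \<in> {a \<in> carrier R. a \<otimes> (b \<otimes> g) \<in> I}" using b g by (simp add: m_lcomm)
      qed
      then have "{a \<in> carrier R. a \<otimes> (b \<otimes> g) \<in> I} = K" using K(2) bg unfolding F_def by blast
      moreover have "a \<otimes> (b \<otimes> g) \<in> I" using ab g a b by (simp add: m_assoc)
      ultimately show "a \<in> K" using a by blast
    qed
  qed
  then show ?thesis using that g by auto
qed

text \<open>Since \<open>P\<close> multiplies \<open>g\<close> into \<open>I\<close>, passing from
  \<open>I\<close> to \<open>I + (g)\<close> adds at most one composition factor in the
  localization. A chain above \<open>I\<close> either always contains \<open>g\<close>, and then
  lies above \<open>I + (g)\<close>, or eventually misses \<open>g\<close>; from there on its terms
  are equal as soon as their saturated sums with \<open>(g)\<close> are.\<close>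

lemma sat_dcc_step:
  assumes P: "primeideal P R" and I: "ideal I R" "saturated P I"
    and g: "g \<in> carrier R" "g \<notin> I" and Pg: "\<And>a. a \<in> P \<Longrightarrow> a \<otimes> g \<in> I"
    and dcc: "sat_dcc P (sat P (I <+>\<^bsub>R\<^esub> PIdl g))"
  shows "sat_dcc P I"
  unfolding sat_dcc_def
proof (intro allI impI)
  fix J :: "nat \<Rightarrow> 'a set"
  assume "\<forall>n. ideal (J n) R \<and> saturated P (J n) \<and> I \<subseteq> J n \<and> J (Suc n) \<subseteq> J n"
  then have J: "ideal (J n) R" "saturated P (J n)" "I \<subseteq> J n" "J (Suc n) \<subseteq> J n" for n by auto
  have J_anti: "J n \<subseteq> J k" if "k \<le> n" for k n using J(4) that by (rule lift_Suc_antimono_le)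
  show "\<exists>N. \<forall>n\<ge>N. J n = J N"
  proof (cases "\<forall>n. g \<in> J n")
    case True
    have "sat P (I <+>\<^bsub>R\<^esub> PIdl g) \<subseteq> J n" for n
      using True J I by (intro sat_subset add_cgenideal_subset) auto
    then show ?thesis using dcc J unfolding sat_dcc_def by blast
  next
    case False
    then obtain N1 where "g \<notin> J N1" by auto
    then have gJ: "g \<notin> J n" if "n \<ge> N1" for n using J_anti that by blast
    define K where "K n = sat P (J n <+>\<^bsub>R\<^esub> PIdl g)" for n
    have "ideal (K n) R" "saturated P (K n)" "sat P (I <+>\<^bsub>R\<^esub> PIdl g) \<subseteq> K n" "K (Suc n) \<subseteq> K n" for n
      unfolding K_def using J g P
      by (auto intro!: ideal_sat saturated_sat sat_mono set_add_cgenideal_mono ideal_add_cgenideal del: subsetI)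
    then obtain N2 where N2: "K n = K N2" if "n \<ge> N2" for n
      using dcc unfolding sat_dcc_def by blast
    define N where "N = max N1 N2"
    have "J n \<subseteq> J n'" if n: "n \<ge> N" "n' \<ge> n" for n n'
    proof
      fix a assume a: "a \<in> J n"
      interpret Jn: ideal "J n" R by (rule J)
      interpret Jn': ideal "J n'" R by (rule J)
      have a_c: "a \<in> carrier R" using a by (rule Jn.Icarr)
      have id: "ideal (J n <+>\<^bsub>R\<^esub> PIdl g) R" using J g ideal_add_cgenideal by blast
      have "a \<in> K n" unfolding K_def using a J(1) g subset_sat[OF P id] ideal_add_cgenideal(2) by blast
      also have "K n = K n'" using N2 n unfolding N_def by (metis max.bounded_iff order_trans)
      finally obtain s where s: "s \<in> carrier R - P" "s \<otimes> a \<in> J n' <+>\<^bsub>R\<^esub> PIdl g" unfolding K_def sat_def by blast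
      then obtain b r where b: "b \<in> J n'" "r \<in> carrier R" "s \<otimes> a = b \<oplus> r \<otimes> g"
        using mem_add_cgenideal_iff[OF J(1) g(1)] by blast
      have bn: "b \<in> J n" using b(1) J_anti n(2) by blast
      have "r \<otimes> g = s \<otimes> a \<ominus> b" unfolding b(3) using b(2) g(1) Jn.Icarr[OF bn] by algebra
      also have "\<dots> \<in> J n" using a bn s by (simp add: Jn.I_l_closed a_minus_def)
      finally have "r \<otimes> g \<in> J n" .
      \<comment> \<open>\<open>g\<close> is outside the saturated ideal \<open>J n\<close>, so a
        multiplier taking it into \<open>J n\<close> must lie in \<open>P\<close>. Then
        \<open>r \<otimes> g\<close> already lies in \<open>I\<close>, hence in
        \<open>J n'\<close>.\<close>
      then have "r \<in> P" using gJ n saturatedD[OF J(2)] b(2) g unfolding N_def by auto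
      then have "s \<otimes> a \<in> J n'" using b Pg J(3) by auto
      then show "a \<in> J n'" using saturatedD[OF J(2)] s a_c by auto
    qed
    then have "\<forall>n\<ge>N. J n = J N" using J_anti by blast
    then show ?thesis by blast
  qed
qed

text \<open>Noetherian induction: for a maximal counterexample \<open>K\<close>, an associated prime
  of \<open>K\<close> contains \<open>I0\<close> and lies in \<open>P\<close>, so it is
  \<open>P\<close> itself. This is the situation of \<open>sat_dcc_step\<close>, and the ideal
  enlarged by \<open>g\<close> is no counterexample.\<close>

lemma sat_dcc_above:
  assumes P: "primeideal P R"
    and only: "\<And>Q. primeideal Q R \<Longrightarrow> I0 \<subseteq> Q \<Longrightarrow> Q \<subseteq> P \<Longrightarrow> Q = P"
    and I: "ideal I R" "saturated P I" "I0 \<subseteq> I"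
  shows "sat_dcc P I"
proof (rule ccontr)
  assume neg: "\<not> sat_dcc P I"
  define F where "F = {I. ideal I R \<and> saturated P I \<and> I0 \<subseteq> I \<and> \<not> sat_dcc P I}"
  have "F \<noteq> {}" using I neg unfolding F_def by blast
  then obtain K where K: "K \<in> F" "\<And>J. J \<in> F \<Longrightarrow> K \<subseteq> J \<Longrightarrow> J = K"
    using obtain_maximal_ideal_in[of F] unfolding F_def by blast
  then have K': "ideal K R" "saturated P K" "I0 \<subseteq> K" "\<not> sat_dcc P K" unfolding F_def by auto
  have "K \<noteq> carrier R"
  proof
    assume "K = carrier R"
    have "sat_dcc P (carrier R)" unfolding sat_dcc_def
      using ideal.Icarr by (metis subsetI subset_antisym)
    then show False using K' \<open>K = carrier R\<close> by simp
  qed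
  then obtain g where g: "g \<in> carrier R" "g \<notin> K" and prm: "primeideal {a \<in> carrier R. a \<otimes> g \<in> K} R" (is "primeideal ?Q R")
    using associated_prime[OF K'(1)] by blast
  interpret K: ideal K R by (rule K')
  have "I0 \<subseteq> ?Q" using K'(3) K.Icarr K.I_r_closed g by blast
  moreover have "?Q \<subseteq> P" using saturatedD[OF K'(2)] g by blast
  ultimately have "?Q = P" using only prm by blast
  have id: "ideal (K <+>\<^bsub>R\<^esub> PIdl g) R" using K'(1) g ideal_add_cgenideal by blast
  have sub: "K <+>\<^bsub>R\<^esub> PIdl g \<subseteq> sat P (K <+>\<^bsub>R\<^esub> PIdl g)" using subset_sat[OF P id] .
  have "g \<in> sat P (K <+>\<^bsub>R\<^esub> PIdl g)" using sub ideal_add_cgenideal(3)[OF K'(1) g(1)] by blast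
  moreover have Ksub: "K \<subseteq> sat P (K <+>\<^bsub>R\<^esub> PIdl g)" using sub ideal_add_cgenideal(2)[OF K'(1) g(1)] by blast
  ultimately have "sat P (K <+>\<^bsub>R\<^esub> PIdl g) \<notin> F" using K(2) g by blast
  then have "sat_dcc P (sat P (K <+>\<^bsub>R\<^esub> PIdl g))"
    unfolding F_def using ideal_sat[OF P id] saturated_sat[OF P id] Ksub K'(3) by blast
  then have "sat_dcc P K" using sat_dcc_step[OF P K'(1,2) g] \<open>?Q = P\<close> by blast
  then show False using K' by blast
qed

text \<open>Otherwise take an ideal maximal among the saturated ideals between \<open>I'\<close> and \<open>I\<close>, \<open>I\<close> excluded.\<close>
lemma saturated_nakayama:
  assumes P: "primeideal P R" and I: "ideal I R" "saturated P I" and I': "ideal I' R" "saturated P I'" "I' \<subseteq> I"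
    and z: "z \<in> P"
    and gen: "\<And>a. a \<in> I \<Longrightarrow> \<exists>s\<in>carrier R - P. \<exists>b\<in>I. \<exists>c\<in>I'. s \<otimes> a = c \<oplus> b \<otimes> z"
  shows "I = I'"
proof (rule ccontr)
  assume "I \<noteq> I'"
  interpret P: primeideal P R by fact
  define F where "F = {K. ideal K R \<and> saturated P K \<and> I' \<subseteq> K \<and> K \<subset> I}"
  have "F \<noteq> {}" using I' \<open>I \<noteq> I'\<close> unfolding F_def by blast
  then obtain K where K: "K \<in> F" "\<And>J. J \<in> F \<Longrightarrow> K \<subseteq> J \<Longrightarrow> J = K"
    using obtain_maximal_ideal_in[of F] unfolding F_def by blast
  then have K': "ideal K R" "saturated P K" "I' \<subseteq> K" "K \<subset> I" unfolding F_def by auto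
  interpret K: ideal K R by (rule K')
  interpret I: ideal I R by (rule I)
  have zc: "z \<in> carrier R" using z by (rule P.Icarr)
  \<comment> \<open>Otherwise maximality makes \<open>I\<close> the saturation of
    \<open>K + (b \<otimes> z)\<close>. Expressing \<open>b\<close> accordingly gives
    \<open>(s \<ominus> r \<otimes> z) \<otimes> b\<close> in \<open>K\<close>, where
    \<open>s \<ominus> r \<otimes> z\<close> is outside \<open>P\<close> because \<open>z\<close> is
    in \<open>P\<close>; so \<open>b\<close> itself is in \<open>K\<close>.\<close>
  have aK: "b \<otimes> z \<in> K" if b: "b \<in> I" for b
  proof (rule ccontr)
    assume bz: "b \<otimes> z \<notin> K"
    have bc: "b \<in> carrier R" using b by (rule I.Icarr)
    have bz_c: "b \<otimes> z \<in> carrier R" using bc zc by blast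
    have id: "ideal (K <+>\<^bsub>R\<^esub> PIdl (b \<otimes> z)) R" using K'(1) bz_c ideal_add_cgenideal by blast
    let ?K = "sat P (K <+>\<^bsub>R\<^esub> PIdl (b \<otimes> z))"
    have sub: "K <+>\<^bsub>R\<^esub> PIdl (b \<otimes> z) \<subseteq> ?K" using subset_sat[OF P id] .
    have "b \<otimes> z \<in> ?K" using sub ideal_add_cgenideal(3)[OF K'(1) bz_c] by blast
    moreover have Ksub: "K \<subseteq> ?K" using sub ideal_add_cgenideal(2)[OF K'(1) bz_c] by blast
    ultimately have "?K \<notin> F" using K(2) bz by blast
    moreover have "?K \<subseteq> I" using b zc I K' by (intro sat_subset add_cgenideal_subset) (auto simp: I.I_r_closed)
    ultimately have "?K = I" unfolding F_def using ideal_sat[OF P id] saturated_sat[OF P id] Ksub K'(3) by blast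
    then have "b \<in> ?K" using b by blast
    then obtain s where s: "s \<in> carrier R - P" "s \<otimes> b \<in> K <+>\<^bsub>R\<^esub> PIdl (b \<otimes> z)" unfolding sat_def by blast
    then obtain k r where k: "k \<in> K" "r \<in> carrier R" "s \<otimes> b = k \<oplus> r \<otimes> (b \<otimes> z)"
      using mem_add_cgenideal_iff[OF K'(1) bz_c] by blast
    have "(s \<ominus> r \<otimes> z) \<otimes> b = s \<otimes> b \<ominus> r \<otimes> (b \<otimes> z)"
      using s k zc bc by simp algebra
    also have "\<dots> = k" unfolding k(3) using k(2) bc zc K.Icarr[OF k(1)] by algebra
    finally have "(s \<ominus> r \<otimes> z) \<otimes> b \<in> K" using k by simp
    moreover have "s \<ominus> r \<otimes> z \<notin> P"
    proof
      assume "s \<ominus> r \<otimes> z \<in> P"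
      then have "(s \<ominus> r \<otimes> z) \<oplus> r \<otimes> z \<in> P" using z k by (simp add: P.I_l_closed)
      also have "(s \<ominus> r \<otimes> z) \<oplus> r \<otimes> z = s" using s k zc by simp algebra
      finally show False using s by blast
    qed
    ultimately have "b \<in> K" using saturatedD[OF K'(2), of "s \<ominus> r \<otimes> z" b] s k zc bc by simp
    then show False using bz zc by (simp add: K.I_r_closed)
  qed
  have "I \<subseteq> K"
  proof
    fix a assume a: "a \<in> I"
    then obtain s b c where "s\<in>carrier R - P" "b\<in>I" "c\<in>I'" "s \<otimes> a = c \<oplus> b \<otimes> z" using gen by blast
    then show "a \<in> K" using aK K'(2,3) I.Icarr[OF a] by (intro saturatedD[of P K s a]) auto
  qed
  then show False using K' by blast
qed

text \<open>Krull's principal ideal theorem for the domain \<open>R/P0\<close>. If the claim failed,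
  \<open>P\<close> would be minimal over \<open>P0 + (z)\<close>, and the descending chain condition
  would hold above that ideal. It is applied to the powers of an element \<open>w\<close> of
  \<open>Q\<close> outside \<open>P0\<close>, taken modulo \<open>P0\<close> and saturated at
  \<open>Q\<close>.\<close>

theorem principal_ideal_theorem:
  assumes P0: "primeideal P0 R" and Q: "primeideal Q R" and P: "primeideal P R"
    and sub: "P0 \<subset> Q" "Q \<subset> P" and z: "z \<in> P" "z \<notin> Q"
  shows "\<exists>P'. primeideal P' R \<and> P0 \<subseteq> P' \<and> z \<in> P' \<and> P' \<subset> P"
proof (rule ccontr)
  assume neg: "\<nexists>P'. primeideal P' R \<and> P0 \<subseteq> P' \<and> z \<in> P' \<and> P' \<subset> P"
  interpret P0: primeideal P0 R by fact
  interpret Q: primeideal Q R by fact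
  interpret P: primeideal P R by fact
  have zc: "z \<in> carrier R" using z P.Icarr by blast
  obtain w where w: "w \<in> Q" "w \<notin> P0" using sub by blast
  have wc: "w \<in> carrier R" using w Q.Icarr by blast
  have wn_c: "w [^] n \<in> carrier R" for n :: nat using wc by simp
  have idw: "ideal (P0 <+>\<^bsub>R\<^esub> PIdl (w [^] n)) R" for n :: nat
    using ideal_add_cgenideal(1)[OF P0.is_ideal wn_c] .
  define I where "I n = sat Q (P0 <+>\<^bsub>R\<^esub> PIdl (w [^] n))" for n :: nat
  have I_id: "ideal (I n) R" and I_sQ: "saturated Q (I n)" for n
    unfolding I_def using ideal_sat[OF Q idw] saturated_sat[OF Q idw] by auto
  have I_sP: "saturated P (I n)" for n using I_sQ[of n] sub(2) unfolding saturated_def by blast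
  have I_anti: "I (Suc n) \<subseteq> I n" for n
    unfolding I_def
  proof (intro sat_mono add_cgenideal_subset P0.is_ideal idw ideal_add_cgenideal(2) wn_c)
    have "w \<otimes> w [^] n \<in> P0 <+>\<^bsub>R\<^esub> PIdl (w [^] n)"
      using ideal.I_l_closed[OF idw ideal_add_cgenideal(3)[OF P0.is_ideal wn_c] wc] .
    then show "w [^] Suc n \<in> P0 <+>\<^bsub>R\<^esub> PIdl (w [^] n)" using wc by (simp add: m_comm)
  qed
  have idIz: "ideal (I n <+>\<^bsub>R\<^esub> PIdl z) R" for n using ideal_add_cgenideal(1)[OF I_id zc] .
  define J where "J n = sat P (I n <+>\<^bsub>R\<^esub> PIdl z)" for n
  have J: "ideal (J n) R" "saturated P (J n)" "J (Suc n) \<subseteq> J n" for n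
    unfolding J_def using ideal_sat[OF P idIz] saturated_sat[OF P idIz] I_anti
    by (auto intro!: sat_mono set_add_cgenideal_mono del: subsetI)
  have P0z: "ideal (P0 <+>\<^bsub>R\<^esub> PIdl z) R" using ideal_add_cgenideal(1)[OF P0.is_ideal zc] .
  have P0I: "P0 \<subseteq> I n" for n
    unfolding I_def using subset_sat[OF Q idw] ideal_add_cgenideal(2)[OF P0.is_ideal wn_c] by blast
  have IJ: "sat P (P0 <+>\<^bsub>R\<^esub> PIdl z) \<subseteq> J n" for n
    unfolding J_def by (intro sat_mono set_add_cgenideal_mono P0I)
  have "sat_dcc P (sat P (P0 <+>\<^bsub>R\<^esub> PIdl z))"
  proof (rule sat_dcc_above[OF P])
    show "Q' = P" if Q': "primeideal Q' R" "P0 <+>\<^bsub>R\<^esub> PIdl z \<subseteq> Q'" "Q' \<subseteq> P" for Q'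
    proof -
      have "P0 \<subseteq> Q'" "z \<in> Q'" using Q'(2) ideal_add_cgenideal(2,3)[OF P0.is_ideal zc] by auto
      then show ?thesis using neg Q' by blast
    qed
  qed (use ideal_sat[OF P P0z] saturated_sat[OF P P0z] subset_sat[OF P P0z] in auto)
  then obtain n where n: "J (Suc n) = J n" using J IJ unfolding sat_dcc_def by (metis le_Suc_eq order_refl)
  \<comment> \<open>Stability of \<open>J\<close> gives
    \<open>s \<otimes> a = c \<oplus> b \<otimes> z\<close> with \<open>c\<close> in
    \<open>I (Suc n)\<close>. As \<open>z\<close> is outside \<open>Q\<close> and \<open>I n\<close>
    is saturated at \<open>Q\<close>, \<open>b\<close> lies in \<open>I n\<close> again, which is
    what the Nakayama argument asks for.\<close>
  have "I n = I (Suc n)"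
  proof (rule saturated_nakayama[OF P I_id I_sP I_id I_sP I_anti z(1)])
    interpret In: ideal "I n" R by (rule I_id)
    fix a assume a: "a \<in> I n"
    then have "a \<in> J n" unfolding J_def using ideal_add_cgenideal(2)[OF I_id zc] subset_sat[OF P idIz] by blast
    then have "a \<in> J (Suc n)" using n by simp
    then obtain s where s: "s \<in> carrier R - P" "s \<otimes> a \<in> I (Suc n) <+>\<^bsub>R\<^esub> PIdl z" unfolding J_def sat_def by blast
    then obtain c b where c: "c \<in> I (Suc n)" "b \<in> carrier R" "s \<otimes> a = c \<oplus> b \<otimes> z"
      using mem_add_cgenideal_iff[OF I_id zc] by blast
    have cn: "c \<in> I n" using c I_anti by blast
    have "z \<otimes> b = s \<otimes> a \<ominus> c" unfolding c(3) using c(2) zc In.Icarr[OF cn] by algebra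
    also have "\<dots> \<in> I n" using a cn s by (simp add: In.I_l_closed a_minus_def)
    finally have "b \<in> I n" using saturatedD[OF I_sQ] zc z c by blast
    then show "\<exists>s\<in>carrier R - P. \<exists>b\<in>I n. \<exists>c\<in>I (Suc n). s \<otimes> a = c \<oplus> b \<otimes> z" using s c by blast
  qed
  moreover have "w [^] n \<in> I n"
    unfolding I_def using subset_sat[OF Q idw] ideal_add_cgenideal(3)[OF P0.is_ideal wn_c] by blast
  ultimately have "w [^] n \<in> I (Suc n)" by simp
  then obtain s where s: "s \<in> carrier R - Q" "s \<otimes> w [^] n \<in> P0 <+>\<^bsub>R\<^esub> PIdl (w [^] Suc n)" unfolding I_def sat_def by blast
  then obtain p r where p: "p \<in> P0" "r \<in> carrier R" "s \<otimes> w [^] n = p \<oplus> r \<otimes> w [^] Suc n"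
    using mem_add_cgenideal_iff[OF P0.is_ideal wn_c] by blast
  \<comment> \<open>No power of \<open>w\<close> lies in the prime \<open>P0\<close>, so
    \<open>s \<ominus> r \<otimes> w\<close> does. Then it lies in \<open>Q\<close>, as does
    \<open>w\<close>, against \<open>s\<close> being outside \<open>Q\<close>.\<close>
  have "w [^] n \<otimes> (s \<ominus> r \<otimes> w) = s \<otimes> w [^] n \<ominus> r \<otimes> w [^] Suc n"
    unfolding nat_pow_Suc using DiffD1[OF s(1)] p(2) wc wn_c[of n] by algebra
  also have "\<dots> = p" unfolding p(3) using p P0.Icarr[OF p(1)] wc wn_c[of "Suc n"] by algebra
  finally have 1: "w [^] n \<otimes> (s \<ominus> r \<otimes> w) \<in> P0" using p by simp
  have "w [^] k \<notin> P0" for k :: nat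
  proof (induction k)
    case 0 then show ?case using primeideal_one_notin[OF P0] by simp
  next
    case (Suc k) then show ?case using primeideal_notin_mult[OF P0, of "w [^] k" w] w wc by auto
  qed
  then have "s \<ominus> r \<otimes> w \<in> P0" using 1 P0.I_prime[OF wn_c, of "s \<ominus> r \<otimes> w"] s p wc by blast
  then have "s \<ominus> r \<otimes> w \<in> Q" using sub by blast
  then have "(s \<ominus> r \<otimes> w) \<oplus> r \<otimes> w \<in> Q" using w p by (simp add: Q.I_l_closed)
  also have "(s \<ominus> r \<otimes> w) \<oplus> r \<otimes> w = s" using s p wc by simp algebra
  finally show False using s by blast
qed


text \<open>The chain is rebuilt from the top. If the second prime \<open>P1\<close> contains
  \<open>z\<close>, dropping \<open>P0\<close> suffices. Otherwise the rebuilt upper part starts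
  with a prime \<open>Q\<close> strictly above \<open>P1\<close>, and the principal ideal theorem
  for \<open>P0 \<subset> P1 \<subset> Q\<close> gives a prime containing \<open>z\<close> between
  \<open>P0\<close> and \<open>Q\<close>.\<close>

lemma exchange_prime_chain:
  assumes "successively (\<subset>) Ps" "\<forall>P\<in>set Ps. primeideal P R" "length Ps \<ge> 2" "z \<in> last Ps"
  shows "\<exists>Qs. successively (\<subset>) Qs \<and> (\<forall>Q\<in>set Qs. primeideal Q R) \<and> length Ps = Suc (length Qs) \<and>
    hd Ps \<subseteq> hd Qs \<and> z \<in> hd Qs \<and> last Qs = last Ps"
  using assms
proof (induction Ps)
  case (Cons P0 Ps)
  show ?case
  proof (cases "z \<in> hd Ps")
    case True
    with Cons.prems show ?thesis
      by (intro exI[of _ Ps]) (cases Ps; auto)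
  next
    case False
    obtain P1 Ps' where Ps: "Ps = P1 # Ps'" using Cons.prems(3) by (cases Ps) auto
    have "Ps' \<noteq> []" using False Cons.prems(4) Ps by auto
    then have "\<exists>Qs. successively (\<subset>) Qs \<and> (\<forall>Q\<in>set Qs. primeideal Q R) \<and> length Ps = Suc (length Qs) \<and>
      hd Ps \<subseteq> hd Qs \<and> z \<in> hd Qs \<and> last Qs = last Ps"
      using Cons.prems Ps by (intro Cons.IH) (auto simp: Suc_le_eq)
    then obtain Qs where Qs: "successively (\<subset>) Qs" "\<forall>Q\<in>set Qs. primeideal Q R" "length Ps = Suc (length Qs)"
      "P1 \<subseteq> hd Qs" "z \<in> hd Qs" "last Qs = last Ps" using Ps by auto
    then obtain Q Qs' where Q: "Qs = Q # Qs'" using \<open>Ps' \<noteq> []\<close> Ps by (cases Qs) auto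
    have "\<exists>P'. primeideal P' R \<and> P0 \<subseteq> P' \<and> z \<in> P' \<and> P' \<subset> Q"
      using Cons.prems Ps Qs Q False by (intro principal_ideal_theorem[of P0 P1 Q z]) auto
    then obtain P' where "primeideal P' R" "P0 \<subseteq> P'" "z \<in> P'" "P' \<subset> Q" by blast
    then show ?thesis using Qs Q Ps
      by (intro exI[of _ "P' # Qs"]) auto
  qed
qed simp

text \<open>Each exchange puts one generator into all primes of the chain at the cost of one prime,
  and minimality of the last prime is inherited relative to the new first one. Once no generators
  are left, minimality puts the last prime inside the first.\<close>

theorem krull_height_theorem:
  assumes "successively (\<subset>) Ps" "\<forall>P\<in>set Ps. primeideal P R" "Ps \<noteq> []" "set zs \<subseteq> last Ps"
    and "\<And>Q. primeideal Q R \<Longrightarrow> hd Ps \<subseteq> Q \<Longrightarrow> set zs \<subseteq> Q \<Longrightarrow> last Ps \<subseteq> Q"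
  shows "length Ps \<le> Suc (length zs)"
  using assms
proof (induction zs arbitrary: Ps)
  case Nil
  show ?case
  proof (rule ccontr)
    assume "\<not> ?thesis"
    then obtain P P' Ps' where Ps: "Ps = P # P' # Ps'"
      by (metis One_nat_def Suc_le_length_iff list.size(3) not_less_eq_eq)
    have "P' \<subseteq> last Ps"
    proof -
      have "sorted_wrt (\<subset>) Ps" using Nil.prems(1) by (subst (asm) successively_conv_sorted_wrt) (auto intro: transpI)
      then show ?thesis using Ps by (cases "Ps' = []") (auto dest: bspec[of _ _ "last Ps'"])
    qed
    moreover have "last Ps \<subseteq> P" using Nil.prems(2) Nil.prems(5)[of P] Ps by simp
    ultimately show False using Nil.prems(1) Ps by auto
  qed
next
  case (Cons z zs)
  show ?case
  proof (cases "length Ps \<ge> 2")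
    case True
    then obtain Qs where Qs: "successively (\<subset>) Qs" "\<forall>Q\<in>set Qs. primeideal Q R" "length Ps = Suc (length Qs)"
      "hd Ps \<subseteq> hd Qs" "z \<in> hd Qs" "last Qs = last Ps"
      using exchange_prime_chain[OF Cons.prems(1,2) True, of z] Cons.prems(4) by auto
    then have "Qs \<noteq> []" using True by auto
    moreover have "last Qs \<subseteq> Q" if "primeideal Q R" "hd Qs \<subseteq> Q" "set zs \<subseteq> Q" for Q
      using Cons.prems(5)[of Q] that Qs by auto
    ultimately have "length Qs \<le> Suc (length zs)" using Cons.IH[of Qs] Qs Cons.prems(4) by auto
    then show ?thesis using Qs by simp
  qed simp
qed

end

section \<open>Weighted monomial ideals in a regular local ring\<close>

lemma (in comm_monoid) finprod_nat_pow_distrib: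
  assumes "\<And>i. i \<in> A \<Longrightarrow> g i \<in> carrier G"
  shows "(\<Otimes>i\<in>A. g i) [^] (k::nat) = (\<Otimes>i\<in>A. g i [^] k)"
  using assms
proof (induction A rule: infinite_finite_induct)
  case (insert a A)
  then show ?case
    by (simp add: Pi_def nat_pow_distrib)
qed simp_all

lemma (in comm_monoid) finprod_nat_pow_sum:
  assumes "t \<in> carrier G" "finite A"
  shows "(\<Otimes>i\<in>A. t [^] (c i :: nat)) = t [^] (\<Sum>i\<in>A. c i)"
  using assms(2) by induction (use assms(1) in \<open>simp_all add: Pi_def nat_pow_mult\<close>)

lemma (in ideal) finsum_mem:
  assumes "\<And>i. i \<in> A \<Longrightarrow> g i \<in> I"
  shows "(\<Oplus>i\<in>A. g i) \<in> I"
  using assms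
proof (induction A rule: infinite_finite_induct)
  case (insert a A)
  then show ?case by (subst finsum_insert) (auto intro: Icarr)
qed simp_all

lemma carrier_FactRing_eq: "carrier (R Quot I) = (\<lambda>a. I +>\<^bsub>R\<^esub> a) ` carrier R"
  by (auto simp: FactRing_simps)

definition wt :: "(nat \<Rightarrow> nat) \<Rightarrow> nat \<Rightarrow> (nat \<Rightarrow> nat) \<Rightarrow> nat" where
  "wt N n \<beta> = (\<Sum>j<n. N j * \<beta> j)"

lemma wt_add: "wt N n (\<lambda>j. \<beta> j + \<gamma> j) = wt N n \<beta> + wt N n \<gamma>"
  by (simp add: wt_def algebra_simps sum.distrib)

lemma wt_single: "l < n \<Longrightarrow> wt N n (\<lambda>j. if j = l then k else 0) = N l * k"
  by (simp add: wt_def if_distrib cong: if_cong)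

section \<open>Monomials and the weighted filtration\<close>

context cring
begin

definition mon :: "'a list \<Rightarrow> (nat \<Rightarrow> nat) \<Rightarrow> 'a" where
  "mon xs \<beta> = (\<Otimes>j\<in>{..<length xs}. (xs ! j) [^] \<beta> j)"

text \<open>With all weights \<open>1\<close> this is the \<open>t\<close>-th power of the ideal
  generated by \<open>xs\<close>; other weights give a filtration adapted to the slope of
  \<open>f\<close>.\<close>

definition wideal :: "'a list \<Rightarrow> (nat \<Rightarrow> nat) \<Rightarrow> nat \<Rightarrow> 'a set" where
  "wideal xs N t = Idl (mon xs ` {\<beta>. t \<le> wt N (length xs) \<beta>})"

context
  fixes xs :: "'a list"
  assumes xs: "set xs \<subseteq> carrier R"
begin

lemma nth_xs_closed [simp]: "j < length xs \<Longrightarrow> xs ! j \<in> carrier R"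
  using xs by auto

lemma mon_closed [simp]: "mon xs \<beta> \<in> carrier R"
  unfolding mon_def by (auto intro!: finprod_closed)

lemma mon_add: "mon xs (\<lambda>j. \<beta> j + \<gamma> j) = mon xs \<beta> \<otimes> mon xs \<gamma>"
proof -
  have "mon xs (\<lambda>j. \<beta> j + \<gamma> j) = (\<Otimes>j\<in>{..<length xs}. (xs ! j) [^] \<beta> j \<otimes> (xs ! j) [^] \<gamma> j)"
    unfolding mon_def by (rule finprod_cong') (auto simp: nat_pow_mult)
  also have "\<dots> = mon xs \<beta> \<otimes> mon xs \<gamma>"
    unfolding mon_def by (rule finprod_multf) auto
  finally show ?thesis .
qed

lemma mon_cong: "(\<And>j. j < length xs \<Longrightarrow> \<beta> j = \<gamma> j) \<Longrightarrow> mon xs \<beta> = mon xs \<gamma>"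
  unfolding mon_def by (auto intro!: finprod_cong')

lemma mon_single: "l < length xs \<Longrightarrow> mon xs (\<lambda>j. if j = l then k else 0) = (xs ! l) [^] k"
proof -
  assume l: "l < length xs"
  have "mon xs (\<lambda>j. if j = l then k else 0) = (\<Otimes>j\<in>{..<length xs}. if l = j then (xs ! j) [^] k else \<one>)"
    unfolding mon_def by (rule finprod_cong') auto
  also have "\<dots> = (xs ! l) [^] k" using l by (subst finprod_singleton) auto
  finally show ?thesis .
qed

lemma mon_0: "mon xs (\<lambda>j. 0) = \<one>"
  unfolding mon_def by simp

lemma ideal_wideal: "ideal (wideal xs N t) R"
  unfolding wideal_def by (intro genideal_ideal) auto

lemma mon_mem_wideal: "t \<le> wt N (length xs) \<beta> \<Longrightarrow> mon xs \<beta> \<in> wideal xs N t"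
  unfolding wideal_def by (rule subsetD[OF genideal_self]) auto

lemma wideal_subset:
  assumes "ideal I R" "\<And>\<beta>. t \<le> wt N (length xs) \<beta> \<Longrightarrow> mon xs \<beta> \<in> I"
  shows "wideal xs N t \<subseteq> I"
  unfolding wideal_def using assms by (intro genideal_minimal) auto

lemma wideal_antimono: "s \<le> t \<Longrightarrow> wideal xs N t \<subseteq> wideal xs N s"
  by (intro wideal_subset ideal_wideal mon_mem_wideal) simp

lemma wideal_0: "wideal xs N 0 = carrier R"
  using mon_mem_wideal[of 0 N "\<lambda>j. 0"] ideal.one_imp_carrier[OF ideal_wideal] by (simp add: mon_0)

text \<open>Colon ideals allow testing on monomials one factor at a time: first \<open>a\<close>
  against a fixed monomial, then \<open>b\<close> against the fixed \<open>a\<close>.\<close>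

lemma wideal_mult:
  assumes a: "a \<in> wideal xs N s" and b: "b \<in> wideal xs N t"
  shows "a \<otimes> b \<in> wideal xs N (s + t)"
proof -
  have 1: "wideal xs N s \<subseteq> {a \<in> carrier R. a \<otimes> mon xs \<gamma> \<in> wideal xs N (s + t)}"
    if "t \<le> wt N (length xs) \<gamma>" for \<gamma>
  proof (intro wideal_subset ideal_colon ideal_wideal mon_closed)
    fix \<beta> assume "s \<le> wt N (length xs) \<beta>"
    then have "s + t \<le> wt N (length xs) (\<lambda>j. \<beta> j + \<gamma> j)" using that by (simp add: wt_add)
    from mon_mem_wideal[OF this]
    show "mon xs \<beta> \<in> {a \<in> carrier R. a \<otimes> mon xs \<gamma> \<in> wideal xs N (s + t)}" by (simp add: mon_add)
  qed
  have ac: "a \<in> carrier R" using a ideal.Icarr[OF ideal_wideal] by blast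
  have "wideal xs N t \<subseteq> {b \<in> carrier R. b \<otimes> a \<in> wideal xs N (s + t)}"
  proof (intro wideal_subset ideal_colon ideal_wideal ac)
    fix \<gamma> assume "t \<le> wt N (length xs) \<gamma>"
    from 1[OF this] show "mon xs \<gamma> \<in> {b \<in> carrier R. b \<otimes> a \<in> wideal xs N (s + t)}"
      using a ac by (auto simp: m_comm)
  qed
  then show ?thesis using b ac by (auto simp: m_comm)
qed

lemma wideal_pow: "a \<in> wideal xs N s \<Longrightarrow> a [^] k \<in> wideal xs N (k * s)"
proof (induction k)
  case 0 then show ?case by (simp add: wideal_0)
next
  case (Suc k)
  then have "a [^] k \<otimes> a \<in> wideal xs N (k * s + s)" by (intro wideal_mult) auto
  then show ?case by (simp add: add.commute)
qed

lemma Idl_subset_wideal: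
  assumes "\<And>j. j < length xs \<Longrightarrow> t \<le> N j"
  shows "Idl (set xs) \<subseteq> wideal xs N t"
proof (intro genideal_minimal ideal_wideal subsetI)
  fix x assume "x \<in> set xs"
  then obtain l where l: "l < length xs" "x = xs ! l" by (auto simp: in_set_conv_nth)
  then have "mon xs (\<lambda>j. if j = l then 1 else 0) \<in> wideal xs N t"
    using assms by (intro mon_mem_wideal) (simp add: wt_single)
  then show "x \<in> wideal xs N t" using l by (simp add: mon_single)
qed

lemma ideal_pow_ideal: "ideal M R \<Longrightarrow> ideal (ideal_pow R M s) R"
  by (induction s) (auto simp: oneideal ideal_prod_is_ideal)

lemma ideal_pow_subset_wideal:
  assumes "\<And>j. j < length xs \<Longrightarrow> t \<le> N j"
  shows "ideal_pow R (Idl (set xs)) s \<subseteq> wideal xs N (s * t)"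
proof (induction s)
  case 0 then show ?case by (simp add: wideal_0)
next
  case (Suc s)
  have sub: "Idl (set xs) \<subseteq> wideal xs N t" by (rule Idl_subset_wideal) (rule assms)
  show ?case
  proof
    fix a assume "a \<in> ideal_pow R (Idl (set xs)) (Suc s)"
    then have "a \<in> ideal_prod R (ideal_pow R (Idl (set xs)) s) (Idl (set xs))" by simp
    then show "a \<in> wideal xs N (Suc s * t)"
    proof induction
      case (prod i j)
      then have "i \<otimes> j \<in> wideal xs N (s * t + t)"
        using Suc sub by (intro wideal_mult) auto
      then show ?case by (simp add: add.commute)
    next
      case (sum s1 s2)
      then show ?case by (simp add: additive_subgroup.a_closed ideal.axioms(1) ideal_wideal)
    qed
  qed
qed

end

end

text \<open>Regularity in the form needed for the height theorem: the maximal ideal is generated by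
  as many elements as some chain of primes ending in it has strict inclusions. Locality enters as
  invertibility of all elements outside \<open>M\<close>.\<close>

locale regular_local = noetherian_cring R for R (structure) +
  fixes M :: "'a set" and xs :: "'a list"
  assumes xs: "set xs \<subseteq> carrier R" and xs_ne: "xs \<noteq> []"
    and M_eq: "M = Idl (set xs)"
    and M_prime: "primeideal M R"
    and notin_M_unit: "\<And>a. a \<in> carrier R \<Longrightarrow> a \<notin> M \<Longrightarrow> a \<in> Units R"
    and prime_chain: "\<exists>Ps. successively (\<subset>) Ps \<and> (\<forall>P\<in>set Ps. primeideal P R) \<and>
          length Ps = Suc (length xs) \<and> last Ps = M"
begin

lemmas [simp] = nth_xs_closed[OF xs] mon_closed[OF xs]

lemma M_ideal: "ideal M R" using M_prime primeideal.axioms(1) by blast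

lemma prime_subset_M: assumes "primeideal Q R" shows "Q \<subseteq> M"
proof
  interpret Q: primeideal Q R by fact
  fix a assume a: "a \<in> Q"
  show "a \<in> M"
  proof (rule ccontr)
    assume "a \<notin> M"
    then have "a \<in> Units R" using notin_M_unit Q.Icarr[OF a] by blast
    then have "inv a \<otimes> a \<in> Q" "inv a \<otimes> a = \<one>" using a Q.I_l_closed Units_inv_closed Units_l_inv by blast+
    then show False using primeideal_one_notin[OF assms] by simp
  qed
qed

lemma nth_in_M: "j < length xs \<Longrightarrow> xs ! j \<in> M"
  unfolding M_eq using genideal_self[OF xs] by auto

text \<open>If \<open>M\<close> lay in every prime over \<open>zs\<close>, the height theorem would
  bound the number of inclusions in the long chain below \<open>M\<close> by
  \<open>length zs\<close>.\<close>

lemma prime_over_few_generators: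
  assumes "set zs \<subseteq> M" "length zs < length xs"
  obtains Q where "primeideal Q R" "set zs \<subseteq> Q" "\<not> M \<subseteq> Q"
proof (rule ccontr)
  assume "\<not> thesis"
  then have *: "M \<subseteq> Q" if "primeideal Q R" "set zs \<subseteq> Q" for Q using that \<open>\<not> thesis\<close> \<open>\<And>Q. _ Q \<Longrightarrow> _ Q \<Longrightarrow> _ Q \<Longrightarrow> thesis\<close> by blast
  obtain Ps where Ps: "successively (\<subset>) Ps" "\<forall>P\<in>set Ps. primeideal P R" "length Ps = Suc (length xs)" "last Ps = M"
    using prime_chain by blast
  have "length Ps \<le> Suc (length zs)"
    using Ps * assms(1) by (intro krull_height_theorem) auto
  then show False using assms Ps by simp
qed

text \<open>Modulo a suitable prime \<open>Q\<close> certain powers of all the parameters agree with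
  one element \<open>\<tau>\<close>, so that a monomial of weight \<open>w\<close> behaves like
  \<open>\<tau>\<close> to the power \<open>w / L\<close>. Membership in larger weight would make a
  power of \<open>\<tau>\<close> divisible by the next one, hence \<open>\<tau>\<close> invertible
  modulo \<open>Q\<close>, although \<open>\<tau>\<close> is in \<open>M\<close>.\<close>

theorem monomial_notin_wideal:
  assumes N: "\<And>j. j < length xs \<Longrightarrow> N j \<ge> 1" and t: "wt N (length xs) a < t"
  shows "mon xs a \<notin> wideal xs N t"
proof
  assume mem: "mon xs a \<in> wideal xs N t"
  define n where "n = length xs"
  have n: "n \<ge> 1" using xs_ne unfolding n_def by (cases xs) auto
  \<comment> \<open>\<open>L\<close> is a common multiple of the weights, and
    \<open>e j = L / N j\<close> is chosen so that each \<open>(xs ! j) [^] e j\<close> has weight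
    \<open>L\<close>.\<close>
  define L where "L = (\<Prod>j<n. N j)"
  define e where "e j = L div N j" for j
  have eN: "e j * N j = L" if "j < n" for j
    unfolding e_def L_def using that by (intro dvd_div_mult_self dvd_prodI) auto
  have L: "L \<ge> 1" unfolding L_def using N prod_ge_1 n_def by (metis lessThan_iff)
  have e: "e j \<ge> 1" if "j < n" for j using eN[OF that] L by (cases "e j") auto
  define \<tau> where "\<tau> = (xs ! (n - 1)) [^] e (n - 1)"
  have \<tau>c: "\<tau> \<in> carrier R" unfolding \<tau>_def using n n_def by auto
  interpret M: primeideal M R by (rule M_prime)
  have powM: "b [^] (k::nat) \<in> M" if "b \<in> M" "k \<ge> 1" for b k
    using that M.Icarr[OF that(1)] by (cases k) (auto simp: M.I_l_closed)
  have \<tau>M: "\<tau> \<in> M" unfolding \<tau>_def using n e nth_in_M n_def by (intro powM) auto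
  \<comment> \<open>Only \<open>n - 1\<close> differences are listed, as the one for the last index
    is zero. That is one element too few for \<open>M\<close> to be minimal over them.\<close>
  define zs where "zs = map (\<lambda>j. (xs ! j) [^] e j \<ominus> \<tau>) [0..<n - 1]"
  have "set zs \<subseteq> M"
    unfolding zs_def using \<tau>M powM[OF nth_in_M] e n_def by (auto simp: a_minus_def)
  moreover have "length zs < length xs" unfolding zs_def using n n_def by simp
  ultimately obtain Q where Q: "primeideal Q R" "set zs \<subseteq> Q" "\<not> M \<subseteq> Q"
    using prime_over_few_generators by blast
  interpret Q: primeideal Q R by (rule Q)
  let ?A = "R Quot Q" and ?\<phi> = "\<lambda>a. Q +>\<^bsub>R\<^esub> a"
  interpret A: "domain" ?A by (rule Q.quotient_is_domain)
  interpret \<phi>: ring_hom_cring R ?A ?\<phi> by (rule Q.rcos_ring_hom_cring)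
  have diff: "a \<ominus> b \<in> Q \<longleftrightarrow> ?\<phi> a = ?\<phi> b" if "a \<in> carrier R" "b \<in> carrier R" for a b
    using quotient_eq_iff_same_a_r_cos[OF Q.is_ideal] that by blast
  have zQ: "(xs ! j) [^] e j \<ominus> \<tau> \<in> Q" if "j < n" for j
  proof (cases "j = n - 1")
    case True then show ?thesis unfolding \<tau>_def[symmetric] using \<tau>c \<tau>_def by (simp add: a_minus_def r_neg)
  next
    case False then show ?thesis using Q(2) that unfolding zs_def by auto
  qed
  have X: "?\<phi> (xs ! j) [^]\<^bsub>?A\<^esub> e j = ?\<phi> \<tau>" if "j < n" for j
    using zQ[OF that] diff[of "(xs ! j) [^] e j" \<tau>] \<tau>c that n_def by (simp add: \<phi>.ring.hom_nat_pow)
  have Xc: "?\<phi> (xs ! j) \<in> carrier ?A" if "j < n" for j using that n_def by simp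
  have Tc: "?\<phi> \<tau> \<in> carrier ?A" using \<tau>c by simp
  have pow_notin: "b [^] (k::nat) \<notin> Q" if "b \<in> carrier R" "b \<notin> Q" for b k
  proof (induction k)
    case 0 then show ?case using primeideal_one_notin[OF Q(1)] by simp
  next
    case (Suc k) then show ?case using primeideal_notin_mult[OF Q(1), of "b [^] k" b] that by auto
  qed
  \<comment> \<open>Otherwise every parameter would have a power in \<open>Q\<close>, and
    \<open>Q\<close> would contain \<open>M\<close>.\<close>
  have "\<tau> \<notin> Q"
  proof
    assume \<tau>Q: "\<tau> \<in> Q"
    have "xs ! j \<in> Q" if "j < n" for j
    proof -
      have "((xs ! j) [^] e j \<ominus> \<tau>) \<oplus> \<tau> \<in> Q" using zQ[OF that] \<tau>Q by simp
      also have "((xs ! j) [^] e j \<ominus> \<tau>) \<oplus> \<tau> = (xs ! j) [^] e j"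
        using \<tau>c that n_def by (simp add: a_minus_def a_assoc l_neg)
      finally show ?thesis using pow_notin[of "xs ! j" "e j"] that n_def by auto
    qed
    then have "set xs \<subseteq> Q" using n_def by (auto simp: in_set_conv_nth)
    then have "M \<subseteq> Q" unfolding M_eq by (intro genideal_minimal Q.is_ideal)
    then show False using Q by simp
  qed
  define W where "W = wt N n a"
  have mon_hom: "?\<phi> (mon xs \<beta>) = (\<Otimes>\<^bsub>?A\<^esub>j\<in>{..<n}. ?\<phi> (xs ! j) [^]\<^bsub>?A\<^esub> \<beta> j)" for \<beta>
  proof -
    have "?\<phi> (mon xs \<beta>) = (\<Otimes>\<^bsub>?A\<^esub>j\<in>{..<n}. (?\<phi> \<circ> (\<lambda>j. (xs ! j) [^] \<beta> j)) j)"
      unfolding mon_def n_def[symmetric] by (rule \<phi>.hom_finprod) (auto simp: n_def)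
    also have "\<dots> = (\<Otimes>\<^bsub>?A\<^esub>j\<in>{..<n}. ?\<phi> (xs ! j) [^]\<^bsub>?A\<^esub> \<beta> j)"
      by (rule A.finprod_cong') (simp_all add: n_def \<phi>.ring.hom_nat_pow Pi_def)
    finally show ?thesis .
  qed
  \<comment> \<open>Since \<open>L = e j * N j\<close>, the exponent \<open>a j * L\<close> of a
    parameter is a multiple of \<open>e j\<close>, and its power becomes \<open>\<tau>\<close> to
    the \<open>N j * a j\<close>.\<close>
  have Tpow: "?\<phi> (mon xs a) [^]\<^bsub>?A\<^esub> L = ?\<phi> \<tau> [^]\<^bsub>?A\<^esub> W"
  proof -
    have "?\<phi> (mon xs a) [^]\<^bsub>?A\<^esub> L = (\<Otimes>\<^bsub>?A\<^esub>j\<in>{..<n}. (?\<phi> (xs ! j) [^]\<^bsub>?A\<^esub> a j) [^]\<^bsub>?A\<^esub> L)"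
      unfolding mon_hom using Xc by (intro A.finprod_nat_pow_distrib) auto
    also have "\<dots> = (\<Otimes>\<^bsub>?A\<^esub>j\<in>{..<n}. ?\<phi> \<tau> [^]\<^bsub>?A\<^esub> (N j * a j))"
    proof (intro A.finprod_cong' refl)
      fix j assume "j \<in> {..<n}"
      then have j: "j < n" by simp
      have "(?\<phi> (xs ! j) [^]\<^bsub>?A\<^esub> a j) [^]\<^bsub>?A\<^esub> L = (?\<phi> (xs ! j) [^]\<^bsub>?A\<^esub> e j) [^]\<^bsub>?A\<^esub> (N j * a j)"
        using Xc[OF j] unfolding eN[OF j, symmetric] by (simp add: A.nat_pow_pow ac_simps)
      then show "(?\<phi> (xs ! j) [^]\<^bsub>?A\<^esub> a j) [^]\<^bsub>?A\<^esub> L = ?\<phi> \<tau> [^]\<^bsub>?A\<^esub> (N j * a j)"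
        using X[OF j] by simp
    qed (use Tc in auto)
    also have "\<dots> = ?\<phi> \<tau> [^]\<^bsub>?A\<^esub> W"
      unfolding W_def wt_def using Tc by (intro A.finprod_nat_pow_sum) auto
    finally show ?thesis .
  qed
  \<comment> \<open>Dividing \<open>\<beta> j\<close> by \<open>e j\<close> with remainder loses
    less than \<open>L\<close> in weight for each variable. The offset \<open>n\<close> pays for the
    total loss, and the quotients supply at least \<open>q\<close> factors
    \<open>\<tau>\<close>.\<close>
  have sub: "wideal xs N (L * (n + q)) \<subseteq> {b \<in> carrier R. ?\<phi> b \<in> PIdl\<^bsub>?A\<^esub> (?\<phi> \<tau> [^]\<^bsub>?A\<^esub> q)}" for q
  proof (intro wideal_subset[OF xs] \<phi>.ring.ideal_vimage A.cgenideal_ideal A.nat_pow_closed Tc)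
    fix \<beta> assume "L * (n + q) \<le> wt N (length xs) \<beta>"
    then have le: "L * (n + q) \<le> (\<Sum>j<n. N j * \<beta> j)" by (simp add: wt_def n_def)
    define c r where "c j = \<beta> j div e j" and "r j = \<beta> j mod e j" for j
    have "(\<Sum>j<n. N j * \<beta> j) \<le> (\<Sum>j<n. L * (c j + 1))"
    proof (rule sum_mono)
      fix j assume "j \<in> {..<n}"
      then have j: "j < n" by simp
      have "\<beta> j = e j * c j + r j" "r j < e j" unfolding c_def r_def using e[OF j] by auto
      then have "\<beta> j \<le> e j * (c j + 1)" by simp
      then have "N j * \<beta> j \<le> N j * (e j * (c j + 1))" by (rule mult_le_mono2)
      also have "\<dots> = L * (c j + 1)" unfolding eN[OF j, symmetric] by (simp add: ac_simps)
      finally show "N j * \<beta> j \<le> L * (c j + 1)" .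
    qed
    also have "\<dots> = L * ((\<Sum>j<n. c j) + n)" by (simp add: sum_distrib_left sum.distrib algebra_simps)
    finally have "L * (n + q) \<le> L * ((\<Sum>j<n. c j) + n)" using le by (rule order_trans[rotated])
    then have "q \<le> (\<Sum>j<n. c j)" using L by simp
    then obtain q' where q': "(\<Sum>j<n. c j) = q' + q" by (metis add.commute le_Suc_ex)
    have "?\<phi> (mon xs \<beta>) = (\<Otimes>\<^bsub>?A\<^esub>j\<in>{..<n}. ?\<phi> (xs ! j) [^]\<^bsub>?A\<^esub> r j \<otimes>\<^bsub>?A\<^esub> ?\<phi> \<tau> [^]\<^bsub>?A\<^esub> c j)"
      unfolding mon_hom
    proof (intro A.finprod_cong' refl)
      fix j assume "j \<in> {..<n}"
      then have j: "j < n" by simp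
      have "?\<phi> (xs ! j) [^]\<^bsub>?A\<^esub> \<beta> j = ?\<phi> (xs ! j) [^]\<^bsub>?A\<^esub> (r j + e j * c j)" unfolding c_def r_def by simp
      also have "\<dots> = ?\<phi> (xs ! j) [^]\<^bsub>?A\<^esub> r j \<otimes>\<^bsub>?A\<^esub> (?\<phi> (xs ! j) [^]\<^bsub>?A\<^esub> e j) [^]\<^bsub>?A\<^esub> c j"
        using Xc[OF j] by (simp add: A.nat_pow_mult A.nat_pow_pow)
      finally show "?\<phi> (xs ! j) [^]\<^bsub>?A\<^esub> \<beta> j = ?\<phi> (xs ! j) [^]\<^bsub>?A\<^esub> r j \<otimes>\<^bsub>?A\<^esub> ?\<phi> \<tau> [^]\<^bsub>?A\<^esub> c j"
        using X[OF j] by simp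
    qed (use Tc Xc in auto)
    also have "\<dots> = (\<Otimes>\<^bsub>?A\<^esub>j\<in>{..<n}. ?\<phi> (xs ! j) [^]\<^bsub>?A\<^esub> r j) \<otimes>\<^bsub>?A\<^esub> (\<Otimes>\<^bsub>?A\<^esub>j\<in>{..<n}. ?\<phi> \<tau> [^]\<^bsub>?A\<^esub> c j)"
      using Tc Xc by (intro A.finprod_multf) auto
    also have "(\<Otimes>\<^bsub>?A\<^esub>j\<in>{..<n}. ?\<phi> \<tau> [^]\<^bsub>?A\<^esub> c j) = ?\<phi> \<tau> [^]\<^bsub>?A\<^esub> q' \<otimes>\<^bsub>?A\<^esub> ?\<phi> \<tau> [^]\<^bsub>?A\<^esub> q"
      using Tc q' by (simp add: A.finprod_nat_pow_sum A.nat_pow_mult)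
    finally have "?\<phi> (mon xs \<beta>) = ((\<Otimes>\<^bsub>?A\<^esub>j\<in>{..<n}. ?\<phi> (xs ! j) [^]\<^bsub>?A\<^esub> r j) \<otimes>\<^bsub>?A\<^esub> ?\<phi> \<tau> [^]\<^bsub>?A\<^esub> q') \<otimes>\<^bsub>?A\<^esub> ?\<phi> \<tau> [^]\<^bsub>?A\<^esub> q"
      using Tc Xc by (simp add: A.m_assoc A.finprod_closed Pi_def)
    moreover have "(\<Otimes>\<^bsub>?A\<^esub>j\<in>{..<n}. ?\<phi> (xs ! j) [^]\<^bsub>?A\<^esub> r j) \<otimes>\<^bsub>?A\<^esub> ?\<phi> \<tau> [^]\<^bsub>?A\<^esub> q' \<in> carrier ?A"
      using Tc Xc by (intro A.m_closed A.finprod_closed A.nat_pow_closed) (auto intro!: A.nat_pow_closed)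
    moreover have "?\<phi> \<tau> [^]\<^bsub>?A\<^esub> q \<in> carrier ?A" using Tc by simp
    ultimately have "?\<phi> (mon xs \<beta>) \<in> PIdl\<^bsub>?A\<^esub> (?\<phi> \<tau> [^]\<^bsub>?A\<^esub> q)"
      using ideal.I_l_closed[OF A.cgenideal_ideal A.cgenideal_self] by simp
    then show "mon xs \<beta> \<in> {b \<in> carrier R. ?\<phi> b \<in> PIdl\<^bsub>?A\<^esub> (?\<phi> \<tau> [^]\<^bsub>?A\<^esub> q)}" by simp
  qed
  \<comment> \<open>The gain from weight \<open>W\<close> to \<open>W + 1\<close> is multiplied by
    \<open>p\<close>; the value \<open>n + 1\<close> covers the loss \<open>n\<close> and leaves one
    extra factor \<open>\<tau>\<close>.\<close>
  define p where "p = n + 1"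
  have "mon xs a \<in> wideal xs N (W + 1)" 
    using subsetD[OF wideal_antimono[OF xs] mem] t unfolding W_def n_def by simp
  then have "mon xs a [^] (L * p) \<in> wideal xs N (L * p * (W + 1))" by (rule wideal_pow[OF xs])
  also have "L * p * (W + 1) = L * (n + (W * p + 1))" unfolding p_def by (simp add: algebra_simps)
  finally have "?\<phi> (mon xs a [^] (L * p)) \<in> PIdl\<^bsub>?A\<^esub> (?\<phi> \<tau> [^]\<^bsub>?A\<^esub> (W * p + 1))" using sub by blast
  moreover have "?\<phi> (mon xs a [^] (L * p)) = ?\<phi> \<tau> [^]\<^bsub>?A\<^esub> (W * p)"
  proof -
    have "?\<phi> (mon xs a [^] (L * p)) = (?\<phi> (mon xs a) [^]\<^bsub>?A\<^esub> L) [^]\<^bsub>?A\<^esub> p"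
      by (simp add: \<phi>.ring.hom_nat_pow A.nat_pow_pow)
    then show ?thesis unfolding Tpow using Tc by (simp add: A.nat_pow_pow)
  qed
  ultimately obtain b where b: "b \<in> carrier ?A" "?\<phi> \<tau> [^]\<^bsub>?A\<^esub> (W * p) = b \<otimes>\<^bsub>?A\<^esub> ?\<phi> \<tau> [^]\<^bsub>?A\<^esub> (W * p + 1)"
    unfolding cgenideal_def by blast
  from b(1) obtain b' where b': "b' \<in> carrier R" "b = ?\<phi> b'" unfolding carrier_FactRing_eq by (rule imageE)
  let ?k = "W * p"
  have \<tau>k: "\<tau> [^] ?k \<in> carrier R" "\<tau> [^] (?k + 1) \<in> carrier R" using \<tau>c by auto
  have "?\<phi> (b' \<otimes> \<tau> [^] (?k + 1)) = b \<otimes>\<^bsub>?A\<^esub> ?\<phi> \<tau> [^]\<^bsub>?A\<^esub> (?k + 1)"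
    unfolding b'(2) using b'(1) \<tau>c by (simp add: \<phi>.ring.hom_nat_pow del: nat_pow_Suc)
  also have "\<dots> = ?\<phi> (\<tau> [^] ?k)" unfolding b(2)[symmetric] using \<tau>c by (simp add: \<phi>.ring.hom_nat_pow)
  \<comment> \<open>Cancelling \<open>\<tau> [^] ?k\<close>, which is outside the prime
    \<open>Q\<close>, leaves \<open>\<one> \<ominus> b' \<otimes> \<tau>\<close> in
    \<open>Q \<subseteq> M\<close>, and with \<open>\<tau>\<close> in \<open>M\<close> this puts
    \<open>\<one>\<close> into \<open>M\<close>.\<close>
  finally have "\<tau> [^] ?k \<ominus> b' \<otimes> \<tau> [^] (?k + 1) \<in> Q"
    by (subst diff[OF \<tau>k(1) m_closed[OF b'(1) \<tau>k(2)]]) (rule sym)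
  also have "\<tau> [^] ?k \<ominus> b' \<otimes> \<tau> [^] (?k + 1) = \<tau> [^] ?k \<otimes> (\<one> \<ominus> b' \<otimes> \<tau>)"
    unfolding Suc_eq_plus1[symmetric] nat_pow_Suc using \<tau>c b'(1) \<tau>k(1) by algebra
  finally have "\<tau> [^] ?k \<otimes> (\<one> \<ominus> b' \<otimes> \<tau>) \<in> Q" .
  then have "\<one> \<ominus> b' \<otimes> \<tau> \<in> Q" 
    using Q.I_prime[OF \<tau>k(1), of "\<one> \<ominus> b' \<otimes> \<tau>"] pow_notin[OF \<tau>c \<open>\<tau> \<notin> Q\<close>] \<tau>c b'(1) by auto
  then have "\<one> \<ominus> b' \<otimes> \<tau> \<in> M" using prime_subset_M[OF Q(1)] by blast
  then have "(\<one> \<ominus> b' \<otimes> \<tau>) \<oplus> b' \<otimes> \<tau> \<in> M" using \<tau>M b'(1) by (simp add: M.I_l_closed)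
  also have "(\<one> \<ominus> b' \<otimes> \<tau>) \<oplus> b' \<otimes> \<tau> = \<one>" using \<tau>c b'(1) by algebra
  finally show False using primeideal_one_notin[OF M_prime] by blast
qed

end

section \<open>Initial monomials\<close>

lemma digit_sum_less:
  assumes "\<And>j. j < n \<Longrightarrow> \<beta> j < (B::nat)"
  shows "(\<Sum>j<n. B ^ j * \<beta> j) < B ^ n"
  using assms
proof (induction n)
  case (Suc n)
  have "(\<Sum>j<Suc n. B ^ j * \<beta> j) < B ^ n + B ^ n * \<beta> n" using Suc by simp
  also have "\<dots> = B ^ n * Suc (\<beta> n)" by simp
  also have "\<dots> \<le> B ^ n * B" using Suc.prems[of n] by (intro mult_le_mono2) simp
  finally show ?case by (simp add: mult.commute)
qed simp

lemma digit_sum_inj: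
  assumes "\<And>j. j < n \<Longrightarrow> \<beta> j < (B::nat)" "\<And>j. j < n \<Longrightarrow> \<gamma> j < B"
    and "(\<Sum>j<n. B ^ j * \<beta> j) = (\<Sum>j<n. B ^ j * \<gamma> j)" "j < n"
  shows "\<beta> j = \<gamma> j"
  using assms
proof (induction n)
  case (Suc n)
  let ?b = "\<Sum>j<n. B ^ j * \<beta> j" and ?c = "\<Sum>j<n. B ^ j * \<gamma> j"
  have less: "?b < B ^ n" "?c < B ^ n" using Suc.prems by (auto intro!: digit_sum_less)
  have eq: "B ^ n * \<beta> n + ?b = B ^ n * \<gamma> n + ?c" using Suc.prems(3) by simp
  have aux: "(P * a + b) div P = a" if "b < P" for P a b :: nat using that by simp
  have "\<beta> n = (B ^ n * \<beta> n + ?b) div B ^ n" using aux[OF less(1)] by simp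
  also have "\<dots> = \<gamma> n" unfolding eq using aux[OF less(2)] by simp
  finally have "\<beta> n = \<gamma> n" .
  moreover then have "?b = ?c" using eq by simp
  ultimately show ?case using Suc by (cases "j = n") auto
qed simp

text \<open>The perturbation by powers of \<open>B\<close> gives small monomials distinct weights.\<close>
definition pert_wt :: "nat \<Rightarrow> nat \<Rightarrow> nat \<Rightarrow> nat \<Rightarrow> nat \<Rightarrow> nat \<Rightarrow> nat" where
  "pert_wt M B p q d j = M * (if j < d then q else p) + B ^ j"

lemma wt_pert_wt:
  "wt (pert_wt M B p q d) (Suc d) \<beta> = M * (q * (\<Sum>j<d. \<beta> j) + p * \<beta> d) + (\<Sum>j<Suc d. B ^ j * \<beta> j)"
proof -
  have "wt (pert_wt M B p q d) (Suc d) \<beta> =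
    (\<Sum>j<d. M * q * \<beta> j + B ^ j * \<beta> j) + (M * p + B ^ d) * \<beta> d"
    by (simp add: wt_def pert_wt_def add_mult_distrib)
  then show ?thesis by (simp add: sum.distrib sum_distrib_left algebra_simps)
qed

text \<open>A weight below \<open>M * B\<close> forces all exponents below \<open>B\<close>. They
  are then the base-\<open>B\<close> digits of a number below \<open>B ^ Suc d \<le> M\<close>, and
  this number is the remainder of the weight modulo \<open>M\<close>.\<close>

lemma pert_wt_inj:
  assumes M: "B ^ Suc d \<le> M" and K: "K < M * B" and pq: "p \<ge> 1" "q \<ge> 1"
    and eq: "wt (pert_wt M B p q d) (Suc d) \<beta> = wt (pert_wt M B p q d) (Suc d) \<gamma>"
    and le: "wt (pert_wt M B p q d) (Suc d) \<beta> \<le> K" and j: "j < Suc d"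
  shows "\<beta> j = \<gamma> j"
proof -
  have small: "\<alpha> j < B" if "wt (pert_wt M B p q d) (Suc d) \<alpha> \<le> K" "j < Suc d" for \<alpha> j
  proof -
    have "M * \<alpha> j \<le> pert_wt M B p q d j * \<alpha> j" unfolding pert_wt_def using pq
      by (intro mult_le_mono1) (auto intro: order_trans[OF _ le_add1])
    also have "\<dots> \<le> wt (pert_wt M B p q d) (Suc d) \<alpha>"
      unfolding wt_def using that(2) by (intro member_le_sum[where f = "\<lambda>j. pert_wt M B p q d j * \<alpha> j"]) auto
    finally have "M * \<alpha> j < M * B" using that(1) K by linarith
    then show ?thesis by (rule mult_less_cancel1[THEN iffD1, THEN conjunct2])
  qed
  have \<beta>: "\<And>j. j < Suc d \<Longrightarrow> \<beta> j < B" using small le by blast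
  have \<gamma>: "\<And>j. j < Suc d \<Longrightarrow> \<gamma> j < B" using small le eq by auto
  have "(\<Sum>j<Suc d. B ^ j * \<beta> j) < M" "(\<Sum>j<Suc d. B ^ j * \<gamma> j) < M"
    using digit_sum_less[of "Suc d" \<beta> B] digit_sum_less[of "Suc d" \<gamma> B] \<beta> \<gamma> M by (auto simp del: sum.lessThan_Suc)
  then have "(\<Sum>j<Suc d. B ^ j * \<beta> j) = wt (pert_wt M B p q d) (Suc d) \<beta> mod M"
    "(\<Sum>j<Suc d. B ^ j * \<gamma> j) = wt (pert_wt M B p q d) (Suc d) \<gamma> mod M"
    unfolding wt_pert_wt by (simp_all del: sum.lessThan_Suc)
  then have "(\<Sum>j<Suc d. B ^ j * \<beta> j) = (\<Sum>j<Suc d. B ^ j * \<gamma> j)" using eq by simp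
  then show ?thesis using digit_sum_inj[of "Suc d" \<beta> B \<gamma> j] \<beta> \<gamma> j by blast
qed

lemma exps_nonzero: "\<alpha> \<in> exps d \<Longrightarrow> \<alpha> \<noteq> (\<lambda>_. 0) \<Longrightarrow> \<exists>j<d. \<alpha> j \<noteq> 0"
  unfolding exps_def by (metis (mono_tags, lifting) ext mem_Collect_eq not_less)

section \<open>Elements with an initial monomial\<close>

context regular_local
begin

text \<open>The weighted initial form of \<open>h\<close> is a unit times one monomial. Phrasing
  this through the filtration avoids the associated graded ring.\<close>

definition has_initial :: "(nat \<Rightarrow> nat) \<Rightarrow> 'a \<Rightarrow> (nat \<Rightarrow> nat) \<Rightarrow> bool" where
  "has_initial N h \<beta> \<longleftrightarrow>
     (\<exists>c\<in>Units R. \<exists>r\<in>wideal xs N (Suc (wt N (length xs) \<beta>)). h = c \<otimes> mon xs \<beta> \<oplus> r)"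

lemma wideal_closed: "a \<in> wideal xs N t \<Longrightarrow> a \<in> carrier R"
  using ideal.Icarr[OF ideal_wideal[OF xs]] by blast

lemma wideal_add: "a \<in> wideal xs N t \<Longrightarrow> b \<in> wideal xs N t \<Longrightarrow> a \<oplus> b \<in> wideal xs N t"
  using additive_subgroup.a_closed[OF ideal.axioms(1)[OF ideal_wideal[OF xs]]] by blast

lemma wideal_minus: "a \<in> wideal xs N t \<Longrightarrow> \<ominus> a \<in> wideal xs N t"
  using additive_subgroup.a_inv_closed[OF ideal.axioms(1)[OF ideal_wideal[OF xs]]] by blast

lemma wideal_l_closed: "a \<in> wideal xs N t \<Longrightarrow> b \<in> carrier R \<Longrightarrow> b \<otimes> a \<in> wideal xs N t"
  using ideal.I_l_closed[OF ideal_wideal[OF xs]] by blast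

lemma has_initial_mem:
  assumes "has_initial N h \<beta>" shows "h \<in> wideal xs N (wt N (length xs) \<beta>)"
proof -
  obtain c r where "c \<in> Units R" "r \<in> wideal xs N (Suc (wt N (length xs) \<beta>))" "h = c \<otimes> mon xs \<beta> \<oplus> r"
    using assms unfolding has_initial_def by blast
  moreover then have "r \<in> wideal xs N (wt N (length xs) \<beta>)"
    using wideal_antimono[OF xs, of "wt N (length xs) \<beta>" "Suc (wt N (length xs) \<beta>)"] by auto
  ultimately show ?thesis
    using wideal_add wideal_l_closed mon_mem_wideal[OF xs] Units_closed by simp
qed

context
  fixes N :: "nat \<Rightarrow> nat"
  assumes N: "\<And>j. j < length xs \<Longrightarrow> N j \<ge> 1"
begin

text \<open>Subtracting the remainder and dividing by the unit would put the initial monomial into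
  larger weight, which \<open>monomial_notin_wideal\<close> excludes. Thus the weight of an initial
  monomial depends on \<open>h\<close> only.\<close>

lemma has_initial_notin:
  assumes "has_initial N h \<beta>" "t > wt N (length xs) \<beta>" shows "h \<notin> wideal xs N t"
proof
  assume h: "h \<in> wideal xs N t"
  obtain c r where c: "c \<in> Units R" "r \<in> wideal xs N (Suc (wt N (length xs) \<beta>))" "h = c \<otimes> mon xs \<beta> \<oplus> r"
    using assms unfolding has_initial_def by blast
  have h': "h \<in> wideal xs N (Suc (wt N (length xs) \<beta>))" 
    using h wideal_antimono[OF xs, of "Suc (wt N (length xs) \<beta>)" t] assms(2) by auto
  have "c \<otimes> mon xs \<beta> = h \<oplus> \<ominus> r" unfolding c(3) using c(1) wideal_closed[OF c(2)] mon_closed[OF xs, of \<beta>] Units_closed by algebra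
  also have "\<dots> \<in> wideal xs N (Suc (wt N (length xs) \<beta>))" using h' c(2) wideal_add wideal_minus by blast
  finally have "inv c \<otimes> (c \<otimes> mon xs \<beta>) \<in> wideal xs N (Suc (wt N (length xs) \<beta>))"
    using wideal_l_closed c(1) by blast
  moreover have "inv c \<otimes> (c \<otimes> mon xs \<beta>) = mon xs \<beta>" using c(1) by (simp add: m_assoc[symmetric] Units_closed)
  ultimately show False using monomial_notin_wideal[OF N lessI] by auto
qed

lemma has_initial_wt_eq:
  assumes "has_initial N h \<beta>" "has_initial N h \<gamma>"
  shows "wt N (length xs) \<beta> = wt N (length xs) \<gamma>"
  using has_initial_notin has_initial_mem assms linorder_neqE_nat by metis

lemma has_initial_mult:
  assumes "has_initial N h \<beta>" "has_initial N f \<gamma>"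
  shows "has_initial N (h \<otimes> f) (\<lambda>j. \<beta> j + \<gamma> j)"
proof -
  let ?w = "wt N (length xs)"
  obtain a r where a: "a \<in> Units R" "r \<in> wideal xs N (Suc (?w \<beta>))" "h = a \<otimes> mon xs \<beta> \<oplus> r"
    using assms unfolding has_initial_def by blast
  obtain b s where b: "b \<in> Units R" "s \<in> wideal xs N (Suc (?w \<gamma>))" "f = b \<otimes> mon xs \<gamma> \<oplus> s"
    using assms unfolding has_initial_def by blast
  have "a \<otimes> mon xs \<beta> \<otimes> s \<in> wideal xs N (?w \<beta> + Suc (?w \<gamma>))"
    using a b by (intro wideal_mult[OF xs] wideal_l_closed mon_mem_wideal[OF xs]) auto
  moreover have "r \<otimes> f \<in> wideal xs N (Suc (?w \<beta>) + ?w \<gamma>)"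
    using a has_initial_mem[OF assms(2)] by (intro wideal_mult[OF xs]) auto
  ultimately have "a \<otimes> mon xs \<beta> \<otimes> s \<oplus> r \<otimes> f \<in> wideal xs N (Suc (?w (\<lambda>j. \<beta> j + \<gamma> j)))"
    by (intro wideal_add) (simp_all add: wt_add)
  moreover have "h \<otimes> f = (a \<otimes> b) \<otimes> mon xs (\<lambda>j. \<beta> j + \<gamma> j) \<oplus> (a \<otimes> mon xs \<beta> \<otimes> s \<oplus> r \<otimes> f)"
    unfolding mon_add[OF xs] a(3) b(3)
    using Units_closed[OF a(1)] Units_closed[OF b(1)] wideal_closed[OF a(2)] wideal_closed[OF b(2)]
      mon_closed[OF xs, of \<beta>] mon_closed[OF xs, of \<gamma>] by algebra
  ultimately show ?thesis unfolding has_initial_def using a(1) b(1) by blast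
qed

text \<open>The weight \<open>t\<close> of \<open>h\<close> is at most \<open>K\<close>, and there
  only one monomial has it; that monomial generates the ideal of weight \<open>t\<close> modulo the
  next one. Its coefficient in \<open>h\<close> is a unit, because a coefficient in \<open>M\<close>
  would raise the weight.\<close>

lemma obtain_initial:
  assumes inj: "\<And>\<beta> \<gamma> j. wt N (length xs) \<beta> = wt N (length xs) \<gamma> \<Longrightarrow> wt N (length xs) \<beta> \<le> K \<Longrightarrow>
      j < length xs \<Longrightarrow> \<beta> j = \<gamma> j"
    and h: "h \<in> carrier R" "h \<notin> wideal xs N (Suc K)"
  obtains \<beta> where "wt N (length xs) \<beta> \<le> K" "has_initial N h \<beta>"
proof -
  let ?w = "wt N (length xs)"
  define s where "s = (LEAST s. h \<notin> wideal xs N s)"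
  have s: "h \<notin> wideal xs N s" "s \<le> Suc K" 
    unfolding s_def using h(2) LeastI[of "\<lambda>s. h \<notin> wideal xs N s" "Suc K"] Least_le[of "\<lambda>s. h \<notin> wideal xs N s" "Suc K"]
    by auto
  \<comment> \<open>\<open>s\<close> is positive because weight \<open>0\<close> gives the whole
    ring, so \<open>t\<close> is the last weight whose ideal contains \<open>h\<close>.\<close>
  then obtain t where t: "s = Suc t" using h(1) wideal_0[OF xs] by (cases s) auto
  have ht: "h \<in> wideal xs N t" using not_less_Least[of t "\<lambda>s. h \<notin> wideal xs N s"] t unfolding s_def by auto
  have "\<exists>\<beta>. ?w \<beta> = t"
  proof (rule ccontr)
    assume "\<nexists>\<beta>. ?w \<beta> = t"
    then have "wideal xs N t \<subseteq> wideal xs N s" unfolding t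
      by (intro wideal_subset[OF xs] ideal_wideal[OF xs] mon_mem_wideal[OF xs]) (metis le_neq_implies_less Suc_leI)
    then show False using ht s by blast
  qed
  then obtain \<beta> where \<beta>: "?w \<beta> = t" by blast
  have id: "ideal (wideal xs N s) R" by (rule ideal_wideal[OF xs])
  have "wideal xs N t \<subseteq> wideal xs N s <+>\<^bsub>R\<^esub> PIdl (mon xs \<beta>)"
  proof (intro wideal_subset[OF xs] ideal_add_cgenideal(1)[OF id] mon_closed[OF xs])
    fix \<gamma> assume \<gamma>: "t \<le> ?w \<gamma>"
    show "mon xs \<gamma> \<in> wideal xs N s <+>\<^bsub>R\<^esub> PIdl (mon xs \<beta>)"
    proof (cases "?w \<gamma> = t")
      case True
      then have "mon xs \<gamma> = mon xs \<beta>" using inj[of \<gamma> \<beta>] \<beta> s t by (intro mon_cong[OF xs]) auto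
      then show ?thesis using ideal_add_cgenideal(3)[OF id] by simp
    next
      case False
      then have "mon xs \<gamma> \<in> wideal xs N s" using \<gamma> t by (intro mon_mem_wideal[OF xs]) auto
      then show ?thesis using ideal_add_cgenideal(2)[OF id mon_closed[OF xs]] by blast
    qed
  qed
  then obtain r c where r: "r \<in> wideal xs N s" "c \<in> carrier R" "h = r \<oplus> c \<otimes> mon xs \<beta>"
    using ht mem_add_cgenideal_iff[OF id mon_closed[OF xs]] by blast
  have "c \<notin> M"
  proof
    assume "c \<in> M"
    then have "c \<in> wideal xs N 1" using Idl_subset_wideal[OF xs, of 1 N] N M_eq by blast
    then have "c \<otimes> mon xs \<beta> \<in> wideal xs N (1 + t)" using \<beta> by (intro wideal_mult[OF xs] mon_mem_wideal[OF xs]) auto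
    then have "h \<in> wideal xs N s" unfolding r(3) using r(1) t by (intro wideal_add) auto
    then show False using s by blast
  qed
  then have "c \<in> Units R" using notin_M_unit r by blast
  moreover have "h = c \<otimes> mon xs \<beta> \<oplus> r" using r wideal_closed[OF r(1)] a_comm mon_closed[OF xs] by simp
  ultimately have "has_initial N h \<beta>" unfolding has_initial_def using r \<beta> t by blast
  then show ?thesis using that[of \<beta>] \<beta> s t by simp
qed

lemma has_initial_sum:
  assumes "finite S" "p0 \<in> S" "\<And>p. p \<in> S \<Longrightarrow> c p \<in> Units R"
    and less: "\<And>p. p \<in> S \<Longrightarrow> p \<noteq> p0 \<Longrightarrow> wt N (length xs) (E p0) < wt N (length xs) (E p)"
  shows "has_initial N (\<Oplus>p\<in>S. c p \<otimes> mon xs (E p)) (E p0)"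
proof -
  have cl: "c p \<otimes> mon xs (E p) \<in> carrier R" if "p \<in> S" for p
    using Units_closed[OF assms(3)[OF that]] mon_closed[OF xs] by simp
  have "(\<Oplus>p\<in>S. c p \<otimes> mon xs (E p)) = (\<Oplus>p\<in>insert p0 (S - {p0}). c p \<otimes> mon xs (E p))"
    using assms(2) by (simp add: insert_absorb)
  also have "\<dots> = c p0 \<otimes> mon xs (E p0) \<oplus> (\<Oplus>p\<in>S - {p0}. c p \<otimes> mon xs (E p))"
    using assms(1,2) cl by (intro finsum_insert) auto
  moreover have "(\<Oplus>p\<in>S - {p0}. c p \<otimes> mon xs (E p)) \<in> wideal xs N (Suc (wt N (length xs) (E p0)))"
    using assms(3) less by (intro ideal.finsum_mem[OF ideal_wideal[OF xs]] wideal_l_closed mon_mem_wideal[OF xs])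
      (auto simp: Suc_le_eq)
  ultimately show ?thesis unfolding has_initial_def using assms(2,3) by metis
qed

end

end

text \<open>The condition on \<open>f \<ominus> y [^] m\<close> encodes that the initial form of
  \<open>f\<close> is the \<open>m\<close>-th power of that of \<open>y\<close>. The parameter
  \<open>y\<close> stands last, at position \<open>length u\<close>, and will get a weight different
  from that of the others.\<close>

locale hironaka_setting = regular_local R M "u @ [y]" for R (structure) and M u y +
  fixes f m S c
  assumes CP: "CP_expansion R u y f S c"
    and f_minus: "f \<ominus> y [^] m \<in> ideal_pow R M (Suc m)"
    and f_closed: "f \<in> carrier R"
begin

abbreviation "d \<equiv> length u"
abbreviation "vars \<equiv> u @ [y]"

definition ex :: "(nat \<Rightarrow> nat) \<times> nat \<Rightarrow> nat \<Rightarrow> nat" where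
  "ex p = (fst p)(d := snd p)"

definition ey :: "nat \<Rightarrow> nat \<Rightarrow> nat" where
  "ey k = (\<lambda>j. if j = d then k else 0)"

lemma y_closed [simp]: "y \<in> carrier R" and u_closed: "set u \<subseteq> carrier R"
  using xs by auto

lemma ex_d: "ex p d = snd p"
  by (simp add: ex_def)

lemma mon_ex: "mon vars (ex p) = cp_monom R u y (fst p) (snd p)"
proof -
  have "mon vars (ex p) = (\<Otimes>j\<in>insert d {..<d}. (vars ! j) [^] ex p j)"
    unfolding mon_def by (simp add: lessThan_Suc)
  also have "\<dots> = (vars ! d) [^] ex p d \<otimes> (\<Otimes>j\<in>{..<d}. (vars ! j) [^] ex p j)"
    by (rule finprod_insert) (auto intro!: nat_pow_closed simp: less_Suc_eq)
  also have "(\<Otimes>j\<in>{..<d}. (vars ! j) [^] ex p j) = (\<Otimes>j\<in>{..<d}. (u ! j) [^] fst p j)"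
    using u_closed by (intro finprod_cong') (auto simp: ex_def nth_append intro!: nat_pow_closed)
  finally have "mon vars (ex p) = y [^] snd p \<otimes> (\<Otimes>j\<in>{..<d}. (u ! j) [^] fst p j)"
    by (simp add: ex_d)
  then show ?thesis unfolding cp_monom_def using u_closed
    by (subst m_comm) (auto simp: ex_def intro!: nat_pow_closed finprod_closed)
qed

lemma mon_ey: "mon vars (ey k) = y [^] k"
  unfolding ey_def using mon_single[OF xs, of d k] by simp

lemma finite_S: "finite S" and S_exps: "p \<in> S \<Longrightarrow> fst p \<in> exps d"
  and S_minimal: "p \<in> S \<Longrightarrow> cp_monom R u y (fst p) (snd p) \<notin>
         Idl\<^bsub>R\<^esub> ((\<lambda>q. cp_monom R u y (fst q) (snd q)) ` (S - {p}))"
  and c_unit: "p \<in> S \<Longrightarrow> c p \<in> Units R"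
  and f_eq: "f = (\<Oplus>p\<in>S. c p \<otimes> mon vars (ex p))"
  using CP unfolding CP_expansion_def mon_ex by auto

section \<open>Which monomials occur in \<open>f\<close>\<close>

lemma ex_inj: "p \<in> S \<Longrightarrow> q \<in> S \<Longrightarrow> (\<And>j. j < Suc d \<Longrightarrow> ex p j = ex q j) \<Longrightarrow> p = q"
proof (rule prod_eqI)
  assume pq: "p \<in> S" "q \<in> S" and eq: "\<And>j. j < Suc d \<Longrightarrow> ex p j = ex q j"
  show "snd p = snd q" using eq[of d] by (simp add: ex_def)
  show "fst p = fst q"
  proof
    fix j show "fst p j = fst q j"
      using eq[of j] S_exps[OF pq(1)] S_exps[OF pq(2)] by (cases "j < d") (auto simp: ex_def exps_def)
  qed
qed

text \<open>If the monomial of \<open>q\<close> divided that of another \<open>p\<close>, the latter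
  would lie in the ideal of the others, against minimality of the generators.\<close>

lemma not_divides:
  assumes "p \<in> S" "q \<in> S" "\<And>j. j < Suc d \<Longrightarrow> ex q j \<le> ex p j"
  shows "p = q"
proof (rule ccontr)
  assume "p \<noteq> q"
  let ?I = "Idl\<^bsub>R\<^esub> ((\<lambda>q. cp_monom R u y (fst q) (snd q)) ` (S - {p}))"
  have sub: "(\<lambda>q. cp_monom R u y (fst q) (snd q)) ` (S - {p}) \<subseteq> carrier R"
    using mon_closed[OF xs] unfolding mon_ex[symmetric] by blast
  have "mon vars (ex q) \<in> ?I"
    unfolding mon_ex by (rule subsetD[OF genideal_self[OF sub]]) (use assms \<open>p \<noteq> q\<close> in auto)
  then have "mon vars (\<lambda>j. ex p j - ex q j) \<otimes> mon vars (ex q) \<in> ?I"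
    using ideal.I_l_closed[OF genideal_ideal[OF sub]] mon_closed[OF xs] by blast
  also have "mon vars (\<lambda>j. ex p j - ex q j) \<otimes> mon vars (ex q) = mon vars (ex p)"
    unfolding mon_add[OF xs, symmetric] using assms(3) by (intro mon_cong[OF xs]) auto
  finally show False using S_minimal[OF assms(1)] unfolding mon_ex by blast
qed

text \<open>With all weights at least \<open>t\<close>, the error in the power \<open>m + 1\<close>
  of \<open>M\<close> has weight at least \<open>Suc m * t\<close>. So \<open>y [^] m\<close> is
  initial as long as \<open>y\<close> is not much heavier than the lightest variable.\<close>

lemma f_has_initial_ey:
  assumes "\<And>j. j < Suc d \<Longrightarrow> N j \<ge> t" "wt N (Suc d) (ey m) < Suc m * t"
  shows "has_initial N f (ey m)"
proof -
  have "f \<ominus> y [^] m \<in> wideal vars N (Suc m * t)"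
    using ideal_pow_subset_wideal[OF xs, of t N "Suc m"] assms(1) f_minus M_eq by auto
  then have "f \<ominus> y [^] m \<in> wideal vars N (Suc (wt N (Suc d) (ey m)))"
    using wideal_antimono[OF xs, of "Suc (wt N (Suc d) (ey m))" "Suc m * t" N] assms(2) by auto
  moreover have "f = \<one> \<otimes> mon vars (ey m) \<oplus> (f \<ominus> y [^] m)"
    unfolding mon_ey using f_closed nat_pow_closed[OF y_closed, of m] by algebra
  ultimately show ?thesis unfolding has_initial_def
    by (intro bexI[of _ \<one>] bexI[of _ "f \<ominus> y [^] m"]) auto
qed

lemma wt_ey: "wt N (Suc d) (ey k) = N d * k"
  unfolding ey_def by (simp add: wt_single)

text \<open>Let \<open>y\<close> have weight \<open>1\<close> and each \<open>u ! j\<close> a weight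
  above \<open>snd p\<close>. Then the pure power in \<open>S\<close> is an initial monomial of
  \<open>f\<close>, and so is \<open>y [^] m\<close>; hence their weights agree.\<close>

lemma pure_power:
  assumes "p \<in> S" "fst p = (\<lambda>_. 0)" shows "snd p = m"
proof -
  define N where "N j = (if j < d then m + snd p + 2 else 1)" for j
  have N: "\<And>j. j < length vars \<Longrightarrow> N j \<ge> 1" unfolding N_def by auto
  have ex_p: "ex p = ey (snd p)" using assms(2) by (auto simp: ex_def ey_def)
  have 1: "has_initial N f (ey m)"
    by (rule f_has_initial_ey[where t = 1]) (use N in \<open>auto simp: wt_ey N_def\<close>)
  have 2: "has_initial N f (ex p)" unfolding f_eq
  proof (rule has_initial_sum[OF N finite_S assms(1) c_unit])
    fix q assume q: "q \<in> S" "q \<noteq> p"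
    show "wt N (length vars) (ex p) < wt N (length vars) (ex q)"
    proof (cases "\<exists>j<d. fst q j \<noteq> 0")
      case True
      then obtain j where j: "j < d" "fst q j \<noteq> 0" by blast
      have "snd p < N j * ex q j" using j unfolding N_def ex_def by (cases "fst q j") auto
      also have "\<dots> \<le> wt N (Suc d) (ex q)"
        unfolding wt_def using j by (intro member_le_sum[where f = "\<lambda>j. N j * ex q j"]) auto
      finally show ?thesis by (simp add: ex_p wt_ey N_def)
    next
      case False
      then have "\<And>j. j < d \<Longrightarrow> ex q j = ex p j" using assms(2) by (simp add: ex_def)
      then have "(\<forall>j<Suc d. ex q j \<le> ex p j) \<or> (\<forall>j<Suc d. ex p j \<le> ex q j)"
        by (metis less_Suc_eq nat_le_linear order_refl)
      then show ?thesis using not_divides[of p q] not_divides[of q p] q assms(1) by blast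
    qed
  qed
  show ?thesis using has_initial_wt_eq[OF N 1 2] by (simp add: ex_p wt_ey N_def)
qed

text \<open>Otherwise every monomial of \<open>f\<close> would involve some \<open>u ! j\<close> of
  weight \<open>m + 2\<close>, and \<open>f\<close> would be heavier than its initial monomial
  \<open>y [^] m\<close>.\<close>

lemma y_pow_in_S: "((\<lambda>_. 0), m) \<in> S"
proof (rule ccontr)
  assume neg: "((\<lambda>_. 0), m) \<notin> S"
  define N where "N j = (if j < d then m + 2 else 1)" for j
  have N: "\<And>j. j < length vars \<Longrightarrow> N j \<ge> 1" unfolding N_def by auto
  have 1: "has_initial N f (ey m)"
    by (rule f_has_initial_ey[where t = 1]) (use N in \<open>auto simp: wt_ey N_def\<close>)
  have "f \<in> wideal vars N (m + 2)" unfolding f_eq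
  proof (intro ideal.finsum_mem[OF ideal_wideal[OF xs]] wideal_l_closed mon_mem_wideal[OF xs] Units_closed[OF c_unit])
    fix q assume q: "q \<in> S"
    have "\<exists>j<d. fst q j \<noteq> 0"
    proof (rule ccontr)
      assume "\<not> ?thesis"
      then have "fst q = (\<lambda>_. 0)" using exps_nonzero[OF S_exps[OF q]] by blast
      with pure_power[OF q] have "q = ((\<lambda>_. 0), m)" by (simp add: prod_eq_iff)
      then show False using neg q by simp
    qed
    then obtain j where j: "j < d" "fst q j \<noteq> 0" by blast
    have "m + 2 \<le> N j * ex q j" using j unfolding N_def ex_def by (cases "fst q j") auto
    also have "\<dots> \<le> wt N (Suc d) (ex q)"
      unfolding wt_def using j by (intro member_le_sum[where f = "\<lambda>j. N j * ex q j"]) auto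
    finally show "m + 2 \<le> wt N (length vars) (ex q)" by simp
  qed auto
  then show False using has_initial_notin[OF N 1, of "m + 2"] by (simp add: wt_ey N_def)
qed

lemma other_in_S:
  assumes "p \<in> S" "p \<noteq> ((\<lambda>_. 0), m)" shows "snd p < m" "\<exists>j<d. fst p j \<noteq> 0"
proof -
  show "snd p < m"
  proof (rule ccontr)
    assume "\<not> snd p < m"
    then have "p = ((\<lambda>_. 0), m)" by (intro not_divides assms y_pow_in_S) (auto simp: ex_def)
    then show False using assms by simp
  qed
  then have "fst p \<noteq> (\<lambda>_. 0)" using pure_power[OF assms(1)] by auto
  then show "\<exists>j<d. fst p j \<noteq> 0" using exps_nonzero[OF S_exps[OF assms(1)]] by blast
qed

lemma least_is_initial:
  assumes N: "\<And>j. j < Suc d \<Longrightarrow> N j \<ge> 1"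
    and inj: "\<And>\<beta> \<gamma> j. wt N (Suc d) \<beta> = wt N (Suc d) \<gamma> \<Longrightarrow> wt N (Suc d) \<beta> \<le> K \<Longrightarrow> j < Suc d \<Longrightarrow> \<beta> j = \<gamma> j"
    and p1: "p1 \<in> S" "wt N (Suc d) (ex p1) \<le> K"
  obtains p0 where "p0 \<in> S" "wt N (Suc d) (ex p0) \<le> wt N (Suc d) (ex p1)" "has_initial N f (ex p0)"
proof -
  obtain p0 where p0: "p0 \<in> S" "\<And>p. p \<in> S \<Longrightarrow> wt N (Suc d) (ex p0) \<le> wt N (Suc d) (ex p)"
    using ex_has_least_nat[of "\<lambda>p. p \<in> S" p1 "\<lambda>p. wt N (Suc d) (ex p)"] p1(1) by blast
  have "has_initial N f (ex p0)" unfolding f_eq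
  proof (rule has_initial_sum[OF _ finite_S p0(1) c_unit])
    fix p assume p: "p \<in> S" "p \<noteq> p0"
    have "wt N (Suc d) (ex p0) \<noteq> wt N (Suc d) (ex p)"
    proof
      assume "wt N (Suc d) (ex p0) = wt N (Suc d) (ex p)"
      moreover have "wt N (Suc d) (ex p0) \<le> K" using p0(2)[OF p1(1)] p1(2) by simp
      ultimately have "p0 = p" using p0(1) p(1) by (intro ex_inj) (auto intro: inj)
      then show False using p by simp
    qed
    then show "wt N (length vars) (ex p0) < wt N (length vars) (ex p)" using p0(2)[OF p(1)] by simp
  qed (use N in auto)
  then show ?thesis using that p0 p1 by blast
qed

text \<open>For nearly equal weights \<open>y [^] m\<close> is the initial monomial of
  \<open>f\<close>, while an exponent of degree below \<open>m\<close> would give a lighter one. The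
  consequence is that every slope is at least \<open>1\<close>, so that later \<open>y\<close>
  weighs at least as much as the other parameters.\<close>

lemma order_le_degree:
  assumes "p \<in> S" shows "m \<le> (\<Sum>j<d. fst p j) + snd p"
proof (rule ccontr)
  define a where "a = (\<Sum>j<d. fst p j)"
  assume "\<not> ?thesis"
  then have lt: "a + snd p < m" unfolding a_def by simp
  \<comment> \<open>\<open>B\<close> exceeds all exponents of \<open>p\<close> and leaves
    \<open>y [^] m\<close> in the range of distinct weights. \<open>W\<close> outweighs the
    perturbation of both monomials, so that a difference of one in the degree decides.\<close>
  define B where "B = Suc (m + a)"
  define W where "W = B ^ Suc d + m * B ^ d + 1"
  define N where "N = pert_wt W B 1 1 d"
  have N: "\<And>j. j < Suc d \<Longrightarrow> N j \<ge> W" unfolding N_def pert_wt_def by simp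
  have W: "W \<ge> 1" "B ^ Suc d \<le> W" "m * B ^ d < W" unfolding W_def by auto
  have wm: "wt N (Suc d) (ey m) = W * m + m * B ^ d"
    by (simp add: wt_ey N_def pert_wt_def algebra_simps)
  have small: "ex p j < B" if "j < Suc d" for j
  proof (cases "j < d")
    case True
    then have "fst p j \<le> a" unfolding a_def by (intro member_le_sum) auto
    then show ?thesis using True unfolding ex_def B_def by simp
  next
    case False then show ?thesis using that lt unfolding ex_def B_def by (simp add: less_Suc_eq)
  qed
  have sum_ex: "(\<Sum>j<d. ex p j) = a" unfolding a_def ex_def by simp
  have wp: "wt N (Suc d) (ex p) < W * m"
  proof -
    have "wt N (Suc d) (ex p) = W * (a + snd p) + (\<Sum>j<Suc d. B ^ j * ex p j)"
      unfolding N_def wt_pert_wt sum_ex ex_d by simp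
    also have "\<dots> < W * (a + snd p) + W"
      by (rule add_strict_left_mono[OF less_le_trans[OF digit_sum_less[OF small] W(2)]])
    also have "\<dots> = W * (a + snd p + 1)" by simp
    also have "\<dots> \<le> W * m" using lt by (intro mult_le_mono2) simp
    finally show ?thesis .
  qed
  have "W * m + m * B ^ d < W * Suc m" using W(3) by simp
  also have "\<dots> \<le> W * B" unfolding B_def by (intro mult_le_mono2) simp
  finally have K: "wt N (Suc d) (ey m) < W * B" unfolding wm .
  obtain p0 where p0: "p0 \<in> S" "wt N (Suc d) (ex p0) \<le> wt N (Suc d) (ex p)" "has_initial N f (ex p0)"
  proof (rule least_is_initial[of N "wt N (Suc d) (ey m)" p])
    show "\<beta> j = \<gamma> j" if "wt N (Suc d) \<beta> = wt N (Suc d) \<gamma>" "wt N (Suc d) \<beta> \<le> wt N (Suc d) (ey m)" "j < Suc d"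
      for \<beta> \<gamma> j
      by (rule pert_wt_inj[OF W(2) K[unfolded N_def] _ _ that(1)[unfolded N_def] that(2)[unfolded N_def] that(3)]) simp_all
    show "wt N (Suc d) (ex p) \<le> wt N (Suc d) (ey m)" using wp wm by simp
    show "1 \<le> N j" if "j < Suc d" for j using order_trans[OF W(1) N[OF that]] .
  qed (use assms in auto)
  have "has_initial N f (ey m)"
    by (rule f_has_initial_ey[of W N]) (use N W(3) in \<open>auto simp: wm\<close>)
  moreover have "1 \<le> N j" if "j < length vars" for j using order_trans[OF W(1) N[of j]] that by simp
  ultimately have "wt N (length vars) (ex p0) = wt N (length vars) (ey m)"
    using p0(3) by (intro has_initial_wt_eq)
  then have "wt N (Suc d) (ex p0) = wt N (Suc d) (ey m)" by simp
  then show False using p0(2) wp wm by simp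
qed

text \<open>Here \<open>p / q\<close> stands for \<delta>. By \<open>face\<close> the monomial of
  \<open>p1\<close> is at most as heavy as \<open>y [^] m\<close> in the unperturbed weights, and by
  \<open>less\<close> the element \<open>g\<close> is heavier than \<open>y [^] k\<close>.\<close>

theorem y_pow_neq:
  assumes pq: "1 \<le> q" "q \<le> p" and p1: "p1 \<in> S" "snd p1 < m"
    and face: "q * (\<Sum>j<d. fst p1 j) + p * snd p1 \<le> p * m"
    and less: "p * k < q * s" and h: "h \<in> carrier R" and g: "g \<in> ideal_pow R M s"
  shows "y [^] k \<noteq> g \<oplus> h \<otimes> f"
proof
  assume eq: "y [^] k = g \<oplus> h \<otimes> f"
  define a where "a = (\<Sum>j<d. fst p1 j)"
  \<comment> \<open>\<open>B\<close> exceeds the \<open>u\<close>-exponents of \<open>p1\<close> and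
    keeps weights distinct up to that of \<open>y [^] (k + m)\<close>. \<open>W\<close> keeps the
    perturbation of \<open>y [^] (k + m)\<close> below one unit of unperturbed weight.\<close>
  define B where "B = Suc ((k + m) * p + a)"
  define W where "W = B ^ Suc d + (k + m) * B ^ d + 1"
  define N where "N = pert_wt W B p q d"
  have N: "N j \<ge> W * q" if "j < Suc d" for j
    unfolding N_def pert_wt_def using pq by (intro trans_le_add1 mult_le_mono2) auto
  have W: "W \<ge> 1" "B ^ Suc d \<le> W" "(k + m) * B ^ d < W" unfolding W_def by auto
  have "1 \<le> W * q" using W(1) pq(1) by simp
  then have N1: "N j \<ge> 1" if "j < length vars" for j using order_trans[OF _ N[of j]] that by simp
  have wy: "wt N (Suc d) (ey l) = W * p * l + B ^ d * l" for l
    by (simp add: wt_ey N_def pert_wt_def algebra_simps)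
  define K where "K = wt N (Suc d) (ey (k + m))"
  have "K = W * ((k + m) * p) + (k + m) * B ^ d" unfolding K_def wy by (simp add: algebra_simps)
  also have "\<dots> < W * ((k + m) * p) + W" using W(3) by simp
  also have "\<dots> \<le> W * B" unfolding B_def by simp
  finally have K: "K < W * B" .
  have inj: "\<beta> j = \<gamma> j" if "wt N (Suc d) \<beta> = wt N (Suc d) \<gamma>" "wt N (Suc d) \<beta> \<le> K" "j < Suc d" for \<beta> \<gamma> j
    using pert_wt_inj[OF W(2) K _ _ that(1)[unfolded N_def] that(2)[unfolded N_def] that(3)] pq by simp
  \<comment> \<open>This breaks a possible tie in \<open>face\<close>: a single \<open>y\<close> is
    perturbed by \<open>B ^ d\<close>, more than all \<open>u\<close>-factors of \<open>p1\<close>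
    together, and \<open>p1\<close> has fewer factors \<open>y\<close> than
    \<open>y [^] m\<close>.\<close>
  have "(\<Sum>j<d. B ^ j * fst p1 j) < B ^ d"
  proof (rule digit_sum_less)
    fix j assume "j < d"
    then have "fst p1 j \<le> a" unfolding a_def by (intro member_le_sum) auto
    then show "fst p1 j < B" unfolding B_def by simp
  qed
  then have digits: "(\<Sum>j<Suc d. B ^ j * ex p1 j) < B ^ d * Suc (snd p1)" by (simp add: ex_def)
  have sum_ex: "(\<Sum>j<d. ex p1 j) = a" unfolding a_def ex_def by simp
  have wp: "wt N (Suc d) (ex p1) < wt N (Suc d) (ey m)"
  proof -
    have "wt N (Suc d) (ex p1) = W * (q * a + p * snd p1) + (\<Sum>j<Suc d. B ^ j * ex p1 j)"
      unfolding N_def wt_pert_wt sum_ex ex_d by simp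
    also have "\<dots> < W * (q * a + p * snd p1) + B ^ d * Suc (snd p1)" using digits by simp
    also have "\<dots> \<le> W * (p * m) + B ^ d * m"
      using face p1 unfolding a_def by (intro add_le_mono mult_le_mono2) auto
    finally show ?thesis unfolding wy by (simp add: mult.assoc)
  qed
  have ey_K: "wt N (Suc d) (ey m) \<le> K" "wt N (Suc d) (ey k) \<le> K"
    unfolding K_def wy by (auto simp: algebra_simps)
  obtain p0 where p0: "p0 \<in> S" "wt N (Suc d) (ex p0) \<le> wt N (Suc d) (ex p1)" "has_initial N f (ex p0)"
  proof (rule least_is_initial[of N K p1])
    show "\<beta> j = \<gamma> j" if "wt N (Suc d) \<beta> = wt N (Suc d) \<gamma>" "wt N (Suc d) \<beta> \<le> K" "j < Suc d" for \<beta> \<gamma> j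
      using that by (rule inj)
    show "1 \<le> N j" if "j < Suc d" for j using N1 that by simp
    show "wt N (Suc d) (ex p1) \<le> K" using wp ey_K(1) by simp
  qed (rule p1)
  have "ex ((\<lambda>_. 0), m) = ey m" by (auto simp: ex_def ey_def)
  then have "p0 \<noteq> ((\<lambda>_. 0), m)" using p0(2) wp by auto
  then obtain j where j: "j < d" "fst p0 j \<noteq> 0" using other_in_S p0(1) by blast
  have gc: "g \<in> carrier R" using ideal.Icarr[OF ideal_pow_ideal[OF xs M_ideal] g] .
  \<comment> \<open>Every variable weighs at least \<open>W * q\<close>, so \<open>g\<close> weighs
    at least \<open>s * (W * q)\<close>. Strictness of \<open>less\<close> leaves a margin of
    \<open>W\<close>, which exceeds the perturbation of \<open>y [^] k\<close>.\<close>
  have "wt N (Suc d) (ey k) < W * (p * k) + W"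
    unfolding wy using W(3) by (simp add: algebra_simps)
  also have "\<dots> = W * Suc (p * k)" by simp
  also have "\<dots> \<le> W * (q * s)" using less by (intro mult_le_mono2) simp
  finally have "Suc (wt N (Suc d) (ey k)) \<le> s * (W * q)" by (simp add: algebra_simps)
  then have gw: "g \<in> wideal vars N (Suc (wt N (length vars) (ey k)))"
    using ideal_pow_subset_wideal[OF xs, of "W * q" N s] N g M_eq
      wideal_antimono[OF xs, of "Suc (wt N (Suc d) (ey k))" "s * (W * q)" N] by auto
  have "h \<otimes> f = \<one> \<otimes> mon vars (ey k) \<oplus> \<ominus> g"
    unfolding mon_ey eq using gc h f_closed by algebra
  then have init_hf: "has_initial N (h \<otimes> f) (ey k)"
    unfolding has_initial_def using wideal_minus[OF gw] by blast
  \<comment> \<open>\<open>h\<close> cannot be heavier than \<open>K\<close>, because the product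
    \<open>h \<otimes> f\<close> has the initial monomial \<open>y [^] k\<close> of weight at most
    \<open>K\<close>. Hence \<open>h\<close> has an initial monomial.\<close>
  have hK: "h \<notin> wideal vars N (Suc K)"
  proof
    assume "h \<in> wideal vars N (Suc K)"
    then have "f \<otimes> h \<in> wideal vars N (Suc K)" using wideal_l_closed f_closed by blast
    then have "h \<otimes> f \<in> wideal vars N (Suc K)" using m_comm[OF f_closed h] by simp
    then show False using has_initial_notin[OF N1 init_hf, of "Suc K"] ey_K(2) by simp
  qed
  obtain \<beta> where \<beta>: "has_initial N h \<beta>"
  proof (rule obtain_initial[where N = N and K = K and h = h])
    show "\<beta> j = \<gamma> j" if "wt N (length vars) \<beta> = wt N (length vars) \<gamma>" "wt N (length vars) \<beta> \<le> K"
      "j < length vars" for \<beta> \<gamma> j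
      using that unfolding length_append_singleton by (rule inj)
  qed (use N1 h hK in auto)
  have wt_eq: "wt N (Suc d) (\<lambda>j. \<beta> j + ex p0 j) = wt N (Suc d) (ey k)"
    using has_initial_wt_eq[OF N1 has_initial_mult[OF N1 \<beta> p0(3)] init_hf] by simp
  \<comment> \<open>Equal weights in the range of distinctness mean equal exponents; but at the
    index \<open>j\<close> the power of \<open>y\<close> has exponent \<open>0\<close> and
    \<open>p0\<close> does not.\<close>
  have "(\<lambda>j. \<beta> j + ex p0 j) j = ey k j"
    by (rule inj) (use ey_K(2) j(1) wt_eq in auto)
  then show False using j by (simp add: ex_def ey_def)
qed

end

section \<open>Powers of the last parameter modulo f\<close>

context hironaka_setting
begin

lemma mon_mem_ideal_pow:
  "t \<le> (\<Sum>j<Suc d. \<beta> j) \<Longrightarrow> mon vars \<beta> \<in> ideal_pow R M t"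
proof (induction t arbitrary: \<beta>)
  case 0 then show ?case using mon_closed[OF xs] by simp
next
  case (Suc t)
  then have "(\<Sum>j<Suc d. \<beta> j) \<noteq> 0" by linarith
  then obtain l where l: "l < Suc d" "\<beta> l \<noteq> 0" by (meson lessThan_iff sum.neutral)
  define \<gamma> where "\<gamma> = \<beta>(l := \<beta> l - 1)"
  have eq: "\<beta> j = \<gamma> j + (if j = l then 1 else 0)" for j using l unfolding \<gamma>_def by auto
  have "(\<Sum>j<Suc d. \<beta> j) = (\<Sum>j<Suc d. \<gamma> j) + 1"
    using l by (simp only: eq sum.distrib) simp
  then have "mon vars \<gamma> \<in> ideal_pow R M t" using Suc by simp
  then have "mon vars \<gamma> \<otimes> vars ! l \<in> ideal_pow R M (Suc t)"
    using nth_in_M[of l] l by (auto intro: ideal_prod.prod)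
  moreover have "mon vars \<beta> = mon vars \<gamma> \<otimes> vars ! l"
  proof -
    have "mon vars \<beta> = mon vars (\<lambda>j. \<gamma> j + (if j = l then 1 else 0))" by (rule mon_cong[OF xs]) (rule eq)
    also have "\<dots> = mon vars \<gamma> \<otimes> vars ! l"
      unfolding mon_add[OF xs] using mon_single[OF xs, of l 1] l xs by simp
    finally show ?thesis .
  qed
  ultimately show ?case by simp
qed

lemma ideal_pow_M: "ideal (ideal_pow R M s) R"
  by (rule ideal_pow_ideal[OF xs M_ideal])

text \<open>The coefficient of \<open>y [^] m\<close> is a unit, so modulo \<open>f\<close> this
  power can be replaced by the remaining terms, all of lower degree in \<open>y\<close>.\<close>

lemma f_split:
  "f = c ((\<lambda>_. 0), m) \<otimes> y [^] m \<oplus> (\<Oplus>p\<in>S - {((\<lambda>_. 0), m)}. c p \<otimes> mon vars (ex p))"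
proof -
  let ?p = "((\<lambda>_. 0), m)"
  have "f = (\<Oplus>p\<in>insert ?p (S - {?p}). c p \<otimes> mon vars (ex p))"
    unfolding insert_Diff[OF y_pow_in_S] by (rule f_eq)
  also have "\<dots> = c ?p \<otimes> mon vars (ex ?p) \<oplus> (\<Oplus>p\<in>S - {?p}. c p \<otimes> mon vars (ex p))"
    using finite_S c_unit Units_closed y_pow_in_S mon_closed[OF xs] by (intro finsum_insert) auto
  also have "ex ?p = ey m" by (auto simp: ex_def ey_def)
  finally show ?thesis unfolding mon_ey .
qed

text \<open>Division by \<open>f\<close>: while the exponent of \<open>y\<close> is at least
  \<open>m\<close>, a factor \<open>y [^] m\<close> is replaced by the other monomials of
  \<open>f\<close>. By \<open>face\<close> this does not lower the weight, and it lowers the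
  exponent of \<open>y\<close>, on which the induction runs.\<close>

lemma mon_mem_ideal_pow_mod_f:
  assumes q: "q \<ge> 1" and m: "m \<ge> 1"
    and face: "\<And>r. r \<in> S \<Longrightarrow> snd r < m \<Longrightarrow> p * m \<le> q * (\<Sum>j<d. fst r j) + p * snd r"
    and wt: "q * s + p * (m - 1) \<le> q * (\<Sum>j<d. \<beta> j) + p * \<beta> d"
  shows "mon vars \<beta> \<in> ideal_pow R M s <+>\<^bsub>R\<^esub> PIdl f"
  using wt
proof (induction "\<beta> d" arbitrary: \<beta> rule: less_induct)
  case less
  let ?I = "ideal_pow R M s <+>\<^bsub>R\<^esub> PIdl f"
  note I = ideal_add_cgenideal[OF ideal_pow_M f_closed, of s]
  interpret I: ideal ?I R by (rule I)
  show ?case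
  proof (cases "\<beta> d < m")
    case True
    \<comment> \<open>The remaining power of \<open>y\<close> accounts for at most the slack
      \<open>p * (m - 1)\<close>, so the \<open>u\<close>-part alone has degree at least
      \<open>s\<close>.\<close>
    then have "p * \<beta> d \<le> p * (m - 1)" by (intro mult_le_mono2) simp
    then have "q * s \<le> q * (\<Sum>j<d. \<beta> j)" using less.prems by linarith
    then have "s \<le> (\<Sum>j<Suc d. \<beta> j)" using q by simp
    then show ?thesis using mon_mem_ideal_pow I(2) by blast
  next
    case False
    define \<gamma> where "\<gamma> = \<beta>(d := \<beta> d - m)"
    have \<gamma>: "(\<Sum>j<d. \<gamma> j) = (\<Sum>j<d. \<beta> j)" "\<gamma> d + m = \<beta> d" unfolding \<gamma>_def using False by auto
    let ?p = "((\<lambda>_. 0), m)"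
    let ?T = "\<Oplus>r\<in>S - {?p}. c r \<otimes> mon vars (ex r)"
    have c_cl: "c r \<otimes> mon vars (ex r) \<in> carrier R" if "r \<in> S" for r
      using c_unit[OF that] Units_closed mon_closed[OF xs] by simp
    have Tc: "?T \<in> carrier R" using c_cl by (intro finsum_closed) auto
    have "mon vars \<gamma> \<otimes> ?T = (\<Oplus>r\<in>S - {?p}. mon vars \<gamma> \<otimes> (c r \<otimes> mon vars (ex r)))"
      using finite_S c_cl mon_closed[OF xs] by (intro finsum_rdistr) auto
    also have "\<dots> \<in> ?I"
    proof (rule I.finsum_mem)
      fix r assume r: "r \<in> S - {?p}"
      then have lt: "snd r < m" using other_in_S(1) by auto
      have "mon vars (\<lambda>j. \<gamma> j + ex r j) \<in> ?I"
      proof (rule less.hyps)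
        show "\<gamma> d + ex r d < \<beta> d" using lt \<gamma>(2) unfolding ex_d by simp
        have "(\<Sum>j<d. \<gamma> j + ex r j) = (\<Sum>j<d. \<beta> j) + (\<Sum>j<d. fst r j)"
          using \<gamma>(1) by (simp add: sum.distrib ex_def)
        then have "q * (\<Sum>j<d. \<gamma> j + ex r j) + p * (\<gamma> d + ex r d) =
            q * (\<Sum>j<d. \<beta> j) + p * \<gamma> d + (q * (\<Sum>j<d. fst r j) + p * snd r)"
          unfolding ex_d by (simp add: algebra_simps)
        also have "\<dots> \<ge> q * (\<Sum>j<d. \<beta> j) + p * \<gamma> d + p * m" using face[of r] r lt by simp
        also have "q * (\<Sum>j<d. \<beta> j) + p * \<gamma> d + p * m = q * (\<Sum>j<d. \<beta> j) + p * \<beta> d"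
          unfolding \<gamma>(2)[symmetric] by (simp add: algebra_simps)
        finally show "q * s + p * (m - 1) \<le> q * (\<Sum>j<d. \<gamma> j + ex r j) + p * (\<gamma> d + ex r d)"
          using less.prems by linarith
      qed
      then have "c r \<otimes> mon vars (\<lambda>j. \<gamma> j + ex r j) \<in> ?I"
        using Units_closed[OF c_unit] r by (intro I.I_l_closed) blast+
      also have "c r \<otimes> mon vars (\<lambda>j. \<gamma> j + ex r j) = mon vars \<gamma> \<otimes> (c r \<otimes> mon vars (ex r))"
        unfolding mon_add[OF xs] using Units_closed[OF c_unit] r mon_closed[OF xs] by (intro m_lcomm) blast+
      finally show "mon vars \<gamma> \<otimes> (c r \<otimes> mon vars (ex r)) \<in> ?I" .
    qed
    finally have T: "mon vars \<gamma> \<otimes> ?T \<in> ?I" .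
    have F: "mon vars \<gamma> \<otimes> f \<in> ?I" using I(3) mon_closed[OF xs] by (intro I.I_l_closed)
    have u: "c ?p \<in> Units R" using c_unit y_pow_in_S by blast
    have "mon vars \<beta> = mon vars (\<lambda>j. \<gamma> j + ey m j)"
      using \<gamma>(2) by (intro mon_cong[OF xs]) (auto simp: \<gamma>_def ey_def)
    then have \<beta>: "mon vars \<beta> = mon vars \<gamma> \<otimes> y [^] m" unfolding mon_add[OF xs] mon_ey .
    have aux: "a \<otimes> (g \<otimes> z) = g \<otimes> (a \<otimes> z \<oplus> t) \<ominus> g \<otimes> t"
      if "a \<in> carrier R" "g \<in> carrier R" "z \<in> carrier R" "t \<in> carrier R" for a g z t
      using that by algebra
    have "c ?p \<otimes> mon vars \<beta> = mon vars \<gamma> \<otimes> (c ?p \<otimes> y [^] m \<oplus> ?T) \<ominus> mon vars \<gamma> \<otimes> ?T"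
      unfolding \<beta> using Units_closed[OF u] Tc mon_closed[OF xs] by (intro aux) auto
    also have "\<dots> \<in> ?I" unfolding f_split[symmetric] using F T by (simp add: a_minus_def)
    finally have "inv (c ?p) \<otimes> (c ?p \<otimes> mon vars \<beta>) \<in> ?I"
      by (rule I.I_l_closed[OF _ Units_inv_closed[OF u]])
    also have "inv (c ?p) \<otimes> (c ?p \<otimes> mon vars \<beta>) = mon vars \<beta>"
      using u Units_closed[OF u] mon_closed[OF xs] by (simp add: m_assoc[symmetric])
    finally show ?thesis .
  qed
qed

corollary y_pow_mem:
  assumes "q \<ge> 1" "m \<ge> 1"
    and "\<And>r. r \<in> S \<Longrightarrow> snd r < m \<Longrightarrow> p * m \<le> q * (\<Sum>j<d. fst r j) + p * snd r"
    and "q * s + p * (m - 1) \<le> p * k"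
  shows "y [^] k \<in> ideal_pow R M s <+>\<^bsub>R\<^esub> PIdl f"
  using mon_mem_ideal_pow_mod_f[OF assms(1-3), of s "ey k"] assms(4) unfolding mon_ey by (simp add: ey_def)

corollary y_pow_mem_bound:
  assumes "1 \<le> q" "q \<le> p" "p1 \<in> S" "snd p1 < m"
    and "q * (\<Sum>j<d. fst p1 j) + p * snd p1 \<le> p * m"
    and mem: "y [^] k \<in> ideal_pow R M s <+>\<^bsub>R\<^esub> PIdl f"
  shows "q * s \<le> p * k"
proof (rule ccontr)
  assume "\<not> ?thesis"
  then have "p * k < q * s" by simp
  moreover obtain g h where "g \<in> ideal_pow R M s" "h \<in> carrier R" "y [^] k = g \<oplus> h \<otimes> f"
    using mem mem_add_cgenideal_iff[OF ideal_pow_M f_closed] by blast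
  ultimately show False using y_pow_neq[OF assms(1-5)] by blast
qed

text \<open>In this case \<open>f\<close> is a unit times \<open>y [^] m\<close>, so the class of
  \<open>y\<close> modulo \<open>f\<close> is nilpotent.\<close>

lemma y_pow_mem_PIdl:
  assumes "\<And>r. r \<in> S \<Longrightarrow> \<not> snd r < m" "m \<le> k"
  shows "y [^] k \<in> ideal_pow R M s <+>\<^bsub>R\<^esub> PIdl f"
proof -
  let ?p = "((\<lambda>_. 0), m)"
  have "S - {?p} = {}" using assms(1) other_in_S(1) by blast
  then have f: "f = c ?p \<otimes> y [^] m" 
    using f_split[unfolded \<open>S - {?p} = {}\<close>] y_pow_in_S c_unit Units_closed by simp
  have u: "c ?p \<in> Units R" using c_unit y_pow_in_S by blast
  have "y [^] k = y [^] (k - m) \<otimes> y [^] m" using assms(2) by (simp add: nat_pow_mult)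
  also have "\<dots> = (y [^] (k - m) \<otimes> inv (c ?p)) \<otimes> f"
  proof -
    have aux: "(a \<otimes> b) \<otimes> (e \<otimes> z) = a \<otimes> (b \<otimes> e) \<otimes> z"
      if "a \<in> carrier R" "b \<in> carrier R" "e \<in> carrier R" "z \<in> carrier R" for a b e z
      using that by algebra
    have "(y [^] (k - m) \<otimes> inv (c ?p)) \<otimes> (c ?p \<otimes> y [^] m) = y [^] (k - m) \<otimes> (inv (c ?p) \<otimes> c ?p) \<otimes> y [^] m"
      using Units_closed[OF u] Units_inv_closed[OF u] by (intro aux) auto
    then show ?thesis using f u by (simp add: Units_l_inv)
  qed
  also have "\<dots> \<in> ideal_pow R M s <+>\<^bsub>R\<^esub> PIdl f"
    using ideal_add_cgenideal(1,3)[OF ideal_pow_M f_closed, of s] u by (auto intro: ideal.I_l_closed)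
  finally show ?thesis .
qed

lemma f_in_M:
  assumes "m \<ge> 1" shows "f \<in> M"
proof -
  interpret M: ideal M R by (rule M_ideal)
  have "f \<ominus> y [^] m \<in> M"
    using f_minus ideal_prod_inter[OF ideal_pow_M M_ideal, of m] by auto
  moreover have "y [^] m \<in> M" using nth_in_M[of d] assms by (cases m) (auto intro: M.I_l_closed)
  ultimately have "(f \<ominus> y [^] m) \<oplus> y [^] m \<in> M" by simp
  also have "(f \<ominus> y [^] m) \<oplus> y [^] m = f" using f_closed nat_pow_closed[OF y_closed, of m] by algebra
  finally show ?thesis .
qed

end

section \<open>The maximal ideal of the quotient by \<open>f\<close> and its powers\<close>

lemma max_ideal_eqI:
  assumes "cring A" and M: "ideal M A" "M \<noteq> carrier A" and units: "\<And>a. a \<in> carrier A \<Longrightarrow> a \<notin> M \<Longrightarrow> a \<in> Units A"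
  shows "max_ideal A = M"
proof -
  interpret A: cring A by fact
  have *: "J \<subseteq> M" if J: "ideal J A" "J \<noteq> carrier A" for J
  proof
    interpret J: ideal J A by fact
    fix a assume a: "a \<in> J"
    show "a \<in> M"
    proof (rule ccontr)
      assume "a \<notin> M"
      then have "a \<in> Units A" using units J.Icarr[OF a] by blast
      then have "inv\<^bsub>A\<^esub> a \<otimes>\<^bsub>A\<^esub> a \<in> J" "inv\<^bsub>A\<^esub> a \<otimes>\<^bsub>A\<^esub> a = \<one>\<^bsub>A\<^esub>"
        using J.I_l_closed[OF a A.Units_inv_closed] A.Units_l_inv by blast+
      then show False using J.one_imp_carrier J by simp
    qed
  qed
  have "maximalideal M A"
    by (rule maximalidealI) (use M * in auto)
  moreover have "J = M" if "maximalideal J A" for J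
  proof -
    interpret J: maximalideal J A by fact
    have "J \<subseteq> M" using *[OF J.is_ideal] J.I_notcarr by auto
    then show ?thesis using J.I_maximal[OF M(1)] M ideal.Icarr[OF M(1)] by blast
  qed
  ultimately show ?thesis unfolding max_ideal_def by (rule the_equality)
qed

lemma (in ring_hom_ring) ideal_prod_image:
  assumes "ideal I R" "ideal J R"
  shows "ideal_prod S (h ` I) (h ` J) = h ` ideal_prod R I J"
proof (intro equalityI subsetI)
  interpret I: ideal I R by fact
  interpret J: ideal J R by fact
  note cl = subsetD[OF R.ideal_prod_in_carrier[OF assms]]
  fix a assume "a \<in> ideal_prod S (h ` I) (h ` J)"
  then show "a \<in> h ` ideal_prod R I J"
  proof induction
    case (prod i j)
    then obtain i' j' where ij: "i = h i'" "i' \<in> I" "j = h j'" "j' \<in> J" by blast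
    then have "i \<otimes>\<^bsub>S\<^esub> j = h (i' \<otimes> j')" using I.Icarr J.Icarr by simp
    then show ?case using ideal_prod.prod[of i' I j' J R] ij by blast
  next
    case (sum a b)
    then obtain a' b' where ab: "a = h a'" "a' \<in> ideal_prod R I J" "b = h b'" "b' \<in> ideal_prod R I J" by blast
    then have "a \<oplus>\<^bsub>S\<^esub> b = h (a' \<oplus> b')" using cl by simp
    then show ?case using ideal_prod.sum[of a' R I J b'] ab by blast
  qed
next
  interpret I: ideal I R by fact
  interpret J: ideal J R by fact
  note cl = subsetD[OF R.ideal_prod_in_carrier[OF assms]]
  fix a assume "a \<in> h ` ideal_prod R I J"
  then obtain a' where a': "a = h a'" "a' \<in> ideal_prod R I J" by blast
  from a'(2) have "h a' \<in> ideal_prod S (h ` I) (h ` J)"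
  proof induction
    case (prod i j) then show ?case using I.Icarr J.Icarr by (simp add: ideal_prod.prod)
  next
    case (sum a b) then show ?case using cl by (simp add: ideal_prod.sum)
  qed
  then show "a \<in> ideal_prod S (h ` I) (h ` J)" using a' by simp
qed

context hironaka_setting
begin

context
  assumes m_ge: "m \<ge> 1"
begin

abbreviation "Rf \<equiv> R Quot (PIdl f)"
abbreviation "proj \<equiv> (\<lambda>a. PIdl f +>\<^bsub>R\<^esub> a)"

lemma PIdl_ideal: "ideal (PIdl f) R"
  by (rule cgenideal_ideal[OF f_closed])

lemma proj_hom: "ring_hom_cring R Rf proj"
  by (rule ideal.rcos_ring_hom_cring[OF PIdl_ideal is_cring])

lemma proj_eq_iff: "a \<in> carrier R \<Longrightarrow> b \<in> carrier R \<Longrightarrow> proj a = proj b \<longleftrightarrow> a \<ominus> b \<in> PIdl f"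
  using quotient_eq_iff_same_a_r_cos[OF PIdl_ideal] by blast

lemma proj_mem_image_iff:
  assumes a: "a \<in> carrier R" and I: "ideal I R"
  shows "proj a \<in> proj ` I \<longleftrightarrow> a \<in> I <+>\<^bsub>R\<^esub> PIdl f"
proof
  interpret I: ideal I R by (rule I)
  assume "proj a \<in> proj ` I"
  then obtain b where b: "b \<in> I" "proj a = proj b" by blast
  then have "a \<ominus> b \<in> PIdl f" using proj_eq_iff[OF a I.Icarr[OF b(1)]] by blast
  then obtain r where r: "r \<in> carrier R" "a \<ominus> b = r \<otimes> f" unfolding cgenideal_def by blast
  have "a = b \<oplus> (a \<ominus> b)" using a I.Icarr[OF b(1)] by algebra
  then have "a = b \<oplus> r \<otimes> f" using r by simp
  then show "a \<in> I <+>\<^bsub>R\<^esub> PIdl f" using mem_add_cgenideal_iff[OF I f_closed] b r by blast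
next
  interpret I: ideal I R by (rule I)
  assume "a \<in> I <+>\<^bsub>R\<^esub> PIdl f"
  then obtain b r where b: "b \<in> I" "r \<in> carrier R" "a = b \<oplus> r \<otimes> f"
    using mem_add_cgenideal_iff[OF I f_closed] by blast
  have "a \<ominus> b = r \<otimes> f" unfolding b(3) using b(2) I.Icarr[OF b(1)] f_closed by algebra
  then have "a \<ominus> b \<in> PIdl f" unfolding cgenideal_def using b by blast
  then have "proj a = proj b" using proj_eq_iff[OF a I.Icarr[OF b(1)]] by blast
  then show "proj a \<in> proj ` I" using b by blast
qed

lemma max_ideal_Rf: "max_ideal Rf = proj ` M"
proof (rule max_ideal_eqI)
  interpret \<phi>: ring_hom_cring R Rf proj by (rule proj_hom)
  show "cring Rf" by (rule \<phi>.S.is_cring)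
  show "ideal (proj ` M) Rf" by (rule ring_ideal_imp_quot_ideal[OF PIdl_ideal M_ideal])
  have sub: "M <+>\<^bsub>R\<^esub> PIdl f \<subseteq> M" by (rule add_cgenideal_subset[OF M_ideal f_in_M[OF m_ge] M_ideal]) simp
  show "proj ` M \<noteq> carrier Rf"
  proof
    assume "proj ` M = carrier Rf"
    then have "proj \<one> \<in> proj ` M" using \<phi>.hom_closed[OF one_closed] by simp
    then have "\<one> \<in> M" using sub proj_mem_image_iff[OF one_closed M_ideal] by blast
    then show False using primeideal_one_notin[OF M_prime] by simp
  qed
  fix b assume b: "b \<in> carrier Rf" "b \<notin> proj ` M"
  from b(1) obtain a where a: "a \<in> carrier R" "b = proj a" unfolding carrier_FactRing_eq by (rule imageE)
  then have u: "a \<in> Units R" using notin_M_unit b(2) by blast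
  have "proj (inv a) \<otimes>\<^bsub>Rf\<^esub> proj a = \<one>\<^bsub>Rf\<^esub>"
    using \<phi>.hom_mult[of "inv a" a] u a by (simp del: \<phi>.hom_mult)
  moreover have "proj a \<otimes>\<^bsub>Rf\<^esub> proj (inv a) = \<one>\<^bsub>Rf\<^esub>"
    using \<phi>.hom_mult[of a "inv a"] u a by (simp del: \<phi>.hom_mult)
  moreover have "proj (inv a) \<in> carrier Rf" using u by simp
  ultimately show "b \<in> Units Rf" unfolding Units_def using a b by blast
qed

lemma ideal_pow_Rf: "ideal_pow Rf (proj ` M) s = proj ` ideal_pow R M s"
proof (induction s)
  case 0 then show ?case by (simp add: carrier_FactRing_eq)
next
  case (Suc s)
  interpret \<phi>: ring_hom_cring R Rf proj by (rule proj_hom)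
  show ?case using \<phi>.ring.ideal_prod_image[OF ideal_pow_M M_ideal] Suc by simp
qed

lemma y_pow_mem_Rf_iff:
  "proj y [^]\<^bsub>Rf\<^esub> (k::nat) \<in> ideal_pow Rf (max_ideal Rf) s \<longleftrightarrow> y [^] k \<in> ideal_pow R M s <+>\<^bsub>R\<^esub> PIdl f"
proof -
  interpret \<phi>: ring_hom_cring R Rf proj by (rule proj_hom)
  have pw: "proj y [^]\<^bsub>Rf\<^esub> k = proj (y [^] k)" by (rule \<phi>.ring.hom_nat_pow[OF y_closed, symmetric])
  show ?thesis unfolding pw max_ideal_Rf ideal_pow_Rf
    by (intro proj_mem_image_iff ideal_pow_M) simp
qed

end

end

section \<open>The asymptotic order\<close>

lemma noetherian_cringI: "Defs.noetherian_ring R \<Longrightarrow> noetherian_cring R"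
proof -
  assume *: "Defs.noetherian_ring R"
  then have R: "cring R" unfolding Defs.noetherian_ring_def by simp
  interpret cring R by (rule R)
  have "\<exists>G\<subseteq>carrier R. finite G \<and> I = Idl\<^bsub>R\<^esub> G" if "ideal I R" for I
    using * that unfolding Defs.noetherian_ring_def by meson
  then show ?thesis by (intro noetherian_cring.intro noetherian_ringI R)
qed

lemma (in noetherian_cring) ex_maximalideal:
  assumes "ideal I R" "I \<noteq> carrier R"
  obtains K where "maximalideal K R" "I \<subseteq> K"
proof -
  define F where "F = {J. ideal J R \<and> I \<subseteq> J \<and> J \<noteq> carrier R}"
  have "I \<in> F" unfolding F_def by (intro CollectI conjI assms subset_refl)
  have "\<exists>K\<in>F. \<forall>J\<in>F. K \<subseteq> J \<longrightarrow> J = K"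
  proof (rule obtain_maximal_ideal_in)
    show "F \<noteq> {}" using \<open>I \<in> F\<close> by force
    show "ideal J R" if "J \<in> F" for J using that unfolding F_def by simp
  qed blast
  then obtain K where K: "K \<in> F" "\<And>J. J \<in> F \<Longrightarrow> K \<subseteq> J \<Longrightarrow> J = K" by blast
  have K': "ideal K R" "I \<subseteq> K" "K \<noteq> carrier R" using CollectD[OF K(1)[unfolded F_def]] by simp_all
  have "maximalideal K R"
  proof (rule maximalidealI)
    show "ideal K R" by (rule K')
    show "carrier R \<noteq> K" using K'(3) by (rule not_sym)
    fix J assume J: "ideal J R" "K \<subseteq> J" "J \<subseteq> carrier R"
    show "J = K \<or> J = carrier R"
    proof (rule disjCI)
      assume "J \<noteq> carrier R"
      then have "J \<in> F" unfolding F_def by (intro CollectI conjI J order_trans[OF K'(2)])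
      then show "J = K" using J(2) by (rule K(2))
    qed
  qed
  then show ?thesis using K'(2) by (rule that)
qed

lemma (in noetherian_cring) local_unit:
  assumes M: "\<And>K. maximalideal K R \<Longrightarrow> K = M" and a: "a \<in> carrier R" "a \<notin> M"
  shows "a \<in> Units R"
proof -
  have "PIdl a = carrier R"
  proof (rule ccontr)
    assume "PIdl a \<noteq> carrier R"
    then obtain K where "maximalideal K R" "PIdl a \<subseteq> K"
      using ex_maximalideal[OF cgenideal_ideal[OF a(1)]] by blast
    moreover from this(1) have "K = M" by (rule M)
    ultimately show False using a(2) cgenideal_self[OF a(1)] by blast
  qed
  then have "\<one> \<in> PIdl a" by simp
  then obtain r where r': "r \<in> carrier R" "\<one> = r \<otimes> a" unfolding cgenideal_def by blast
  note r = r'(1) r'(2)[symmetric]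
  then have "a \<otimes> r = \<one>" using m_comm[OF a(1) r(1)] by simp
  then show ?thesis unfolding Units_def using a(1) r by blast
qed

lemma regular_localI:
  assumes "regular_system_of_parameters R n xs" "xs \<noteq> []"
  shows "regular_local R (max_ideal R) xs"
proof -
  have reg: "regular_local_ring R n" and len: "length xs = n" and xs: "set xs \<subseteq> carrier R"
    and M_eq: "max_ideal R = Idl\<^bsub>R\<^esub> (set xs)"
    using assms(1) unfolding regular_system_of_parameters_def by auto
  have noeth: "Defs.noetherian_ring R" and loc: "local_ring R" and dim: "krull_dim R = enat n"
    using reg unfolding regular_local_ring_def by auto
  interpret noetherian_cring R by (rule noetherian_cringI[OF noeth])
  define M where "M = max_ideal R"
  have ex1: "\<exists>!M. maximalideal M R" using loc unfolding local_ring_def by blast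
  have M: "maximalideal M R" unfolding M_def max_ideal_def by (rule theI'[OF ex1])
  have uniq: "K = M" if "maximalideal K R" for K using ex1 M that by blast
  have M_prime: "primeideal M R" by (rule maximalideal_prime[OF M])
  have le_M: "P \<subseteq> M" if "primeideal P R" for P

  proof -
    interpret P: primeideal P R by fact
    obtain K where "maximalideal K R" "P \<subseteq> K"
      using ex_maximalideal[OF P.is_ideal] P.I_notcarr by blast
    then show ?thesis using uniq by blast
  qed
  define chains where "chains = {Ps. Ps \<noteq> [] \<and> (\<forall>P\<in>set Ps. primeideal P R) \<and>
                      (\<forall>i. Suc i < length Ps \<longrightarrow> Ps ! i \<subset> Ps ! Suc i)}"
  have n: "n \<noteq> 0" using len assms(2) by auto
  \<comment> \<open>If all chains had fewer than \<open>n\<close> inclusions, their supremum would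
    be at most \<open>n - 1\<close>, which is smaller than the dimension because \<open>n\<close> is
    positive.\<close>
  have "\<exists>Ps\<in>chains. n \<le> length Ps - 1"
  proof (rule ccontr)
    assume "\<not> ?thesis"
    then have "(SUP Ps\<in>chains. enat (length Ps - 1)) \<le> enat (n - 1)"
      by (intro SUP_least) (auto simp: not_le)
    then show False using dim n unfolding krull_dim_def chains_def by simp
  qed
  then obtain Ps where Ps_chains: "Ps \<in> chains" "n \<le> length Ps - 1" by (rule bexE)
  have Ps: "\<forall>P\<in>set Ps. primeideal P R" "\<And>i. Suc i < length Ps \<Longrightarrow> Ps ! i \<subset> Ps ! Suc i"
    using Ps_chains(1) unfolding chains_def by simp_all
  have Ps_len: "n < length Ps" using Ps_chains n by simp
  \<comment> \<open>The chain is only known to have at least \<open>n + 1\<close> members and need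
    not end in \<open>M\<close>. Its first \<open>n\<close> primes lie strictly below
    \<open>Ps ! n \<subseteq> M\<close>, so appending \<open>M\<close> gives a chain of the required
    length and end.\<close>
  define Qs where "Qs = take n Ps @ [M]"
  have "successively (\<subset>) (take n Ps)"
    unfolding successively_conv_nth using Ps(2) Ps_len by simp
  moreover have "last (take n Ps) \<subset> M"
  proof -
    have "last (take n Ps) = Ps ! (n - 1)" using Ps_len n by (subst last_conv_nth) auto
    moreover have "Ps ! (n - 1) \<subset> Ps ! n" using Ps(2)[of "n - 1"] Ps_len n by simp
    moreover have "Ps ! n \<subseteq> M" using le_M Ps(1) Ps_len by simp
    ultimately show ?thesis by blast
  qed
  ultimately have "successively (\<subset>) Qs" unfolding Qs_def by (simp add: successively_append_iff)
  moreover have "\<forall>P\<in>set Qs. primeideal P R" unfolding Qs_def using Ps(1) M_prime by (auto dest: in_set_takeD)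
  moreover have "length Qs = Suc (length xs)" "last Qs = M" unfolding Qs_def using Ps_len len by auto
  ultimately have chain: "\<exists>Ps. successively (\<subset>) Ps \<and> (\<forall>P\<in>set Ps. primeideal P R) \<and>
          length Ps = Suc (length xs) \<and> last Ps = M" by blast
  have "regular_local R M xs"
  proof (intro regular_local.intro regular_local_axioms.intro)
    show "noetherian_cring R" by unfold_locales
    show "a \<in> Units R" if "a \<in> carrier R" "a \<notin> M" for a using uniq that by (rule local_unit)
    show "M = Idl\<^bsub>R\<^esub> (set xs)" unfolding M_def by (rule M_eq)
  qed (rule xs assms(2) M_prime chain)+
  then show ?thesis unfolding M_def .
qed

section \<open>The minimum of the coordinate sum over the polyhedron\<close>

definition slope :: "nat \<Rightarrow> nat \<Rightarrow> (nat \<Rightarrow> nat) \<times> nat \<Rightarrow> real" where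
  "slope d m p = real (\<Sum>l<d. fst p l) / real (m - snd p)"

lemma delta_poly_empty:
  assumes "\<And>p. p \<in> S \<Longrightarrow> \<not> snd p < m"
  shows "delta_poly d (hironaka_poly d m S) = \<infinity>"
proof -
  have "{\<gamma>. \<exists>\<alpha> i \<beta>. (\<alpha>, i) \<in> S \<and> i < m \<and> \<beta> \<in> exps d \<and>
          \<gamma> = (\<lambda>l. real (\<alpha> l) / real (m - i) + real (\<beta> l))} = {}" using assms by fastforce
  then have "hironaka_poly d m S = {}" unfolding hironaka_poly_def conv_hull_def by auto
  then show ?thesis by (simp add: delta_poly_def top_ereal_def)
qed

text \<open>\<open>slope\<close> is the coordinate sum of the point
  \<open>\<alpha> / (m - i)\<close>. The coordinate sum is linear, so a lower bound on generators
  passes to the convex hull, and translation by a natural vector cannot decrease it.\<close>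

lemma delta_poly_eq_slope:
  assumes p1: "p1 \<in> S" "snd p1 < m"
    and min: "\<And>p. p \<in> S \<Longrightarrow> snd p < m \<Longrightarrow> slope d m p1 \<le> slope d m p"
  shows "delta_poly d (hironaka_poly d m S) = ereal (slope d m p1)"
proof -
  define G where "G = {\<gamma>. \<exists>\<alpha> i \<beta>. (\<alpha>, i) \<in> S \<and> i < m \<and> \<beta> \<in> exps d \<and>
          \<gamma> = (\<lambda>l. real (\<alpha> l) / real (m - i) + real (\<beta> l))}"
  have G: "slope d m p1 \<le> (\<Sum>l<d. \<gamma> l)" if "\<gamma> \<in> G" for \<gamma>
  proof -
    from that obtain \<alpha> i \<beta> where *: "(\<alpha>, i) \<in> S" "i < m" "\<gamma> = (\<lambda>l. real (\<alpha> l) / real (m - i) + real (\<beta> l))"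
      unfolding G_def by blast
    have "slope d m p1 \<le> slope d m (\<alpha>, i)" using min * by simp
    also have "\<dots> \<le> (\<Sum>l<d. \<gamma> l)" unfolding * slope_def
      by (simp add: sum.distrib sum_divide_distrib[symmetric] sum_nonneg)
    finally show ?thesis .
  qed
  have lower: "slope d m p1 \<le> (\<Sum>l<d. \<gamma> l)" if "\<gamma> \<in> conv_hull G" for \<gamma>
  proof -
    from that obtain J wt pt where J: "finite (J::nat set)" "\<And>j. j \<in> J \<Longrightarrow> wt j \<ge> 0 \<and> pt j \<in> G"
      "(\<Sum>j\<in>J. wt j) = (1::real)" "\<gamma> = (\<lambda>l::nat. \<Sum>j\<in>J. wt j * pt j l)"
      unfolding conv_hull_def by blast
    have "slope d m p1 = (\<Sum>j\<in>J. wt j * slope d m p1)" using J(3) by (simp add: sum_distrib_right[symmetric])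
    also have "\<dots> \<le> (\<Sum>j\<in>J. wt j * (\<Sum>l<d. pt j l))"
      using J(2) G by (intro sum_mono mult_left_mono) auto
    also have "\<dots> = (\<Sum>l<d. \<gamma> l)" unfolding J(4) sum_distrib_left by (rule sum.swap)
    finally show ?thesis .
  qed
  \<comment> \<open>The bound is attained at the point of \<open>p1\<close>, with zero translation
    and a convex combination of one point.\<close>
  let ?\<gamma> = "\<lambda>l. real (fst p1 l) / real (m - snd p1)"
  have "?\<gamma> \<in> G" unfolding G_def using p1
    by (intro CollectI exI[of _ "fst p1"] exI[of _ "snd p1"] exI[of _ "\<lambda>_. 0"]) (auto simp: exps_def)
  then have "?\<gamma> \<in> conv_hull G" unfolding conv_hull_def
    by (intro CollectI exI[of _ "{0}"] exI[of _ "\<lambda>_. 1"] exI[of _ "\<lambda>_. ?\<gamma>"]) auto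
  moreover have "(\<Sum>l<d. ?\<gamma> l) = slope d m p1" by (simp add: slope_def sum_divide_distrib)
  ultimately have "ereal (slope d m p1) \<in> (\<lambda>\<gamma>. ereal (\<Sum>l<d. \<gamma> l)) ` conv_hull G"
    by (metis (no_types, lifting) image_eqI)
  then have "Inf ((\<lambda>\<gamma>. ereal (\<Sum>l<d. \<gamma> l)) ` conv_hull G) = ereal (slope d m p1)"
    using lower by (intro antisym Inf_lower Inf_greatest) auto
  then show ?thesis unfolding delta_poly_def hironaka_poly_def G_def .
qed

text \<open>The error \<open>C\<close> is independent of \<open>k\<close> and disappears after
  division by \<open>k\<close>. The sandwich also yields convergence, so that \<open>lim\<close>
  denotes a true limit.\<close>

lemma asym_ord_eqI:
  assumes ub: "\<And>k s. a [^]\<^bsub>A\<^esub> (k::nat) \<in> ideal_pow A M s \<Longrightarrow> real s \<le> \<delta> * real k"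
    and lb: "\<And>k. \<exists>s. a [^]\<^bsub>A\<^esub> (k::nat) \<in> ideal_pow A M s \<and> \<delta> * real k - C \<le> real s"
  shows "asym_ord A M a = ereal \<delta>"
  unfolding asym_ord_def
proof (rule limI, rule tendsto_sandwich)
  let ?o = "\<lambda>k. ord_ideal A M (a [^]\<^bsub>A\<^esub> Suc k) / ereal (real (Suc k))"
  have upper: "ord_ideal A M (a [^]\<^bsub>A\<^esub> k) \<le> ereal (\<delta> * real k)" for k :: nat
    unfolding ord_ideal_def using ub by (intro SUP_least) auto
  have lower: "ereal (\<delta> * real k - C) \<le> ord_ideal A M (a [^]\<^bsub>A\<^esub> k)" for k :: nat
  proof -
    obtain s where s: "a [^]\<^bsub>A\<^esub> k \<in> ideal_pow A M s" "\<delta> * real k - C \<le> real s" using lb by blast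
    then have "ereal (\<delta> * real k - C) \<le> ereal (real s)" by simp
    also have "\<dots> \<le> ord_ideal A M (a [^]\<^bsub>A\<^esub> k)" unfolding ord_ideal_def using s(1) by (intro SUP_upper) auto
    finally show ?thesis .
  qed
  show "\<forall>\<^sub>F k in sequentially. ereal ((\<delta> * real (Suc k) - C) / real (Suc k)) \<le> ?o k"
  proof (intro always_eventually allI)
    fix k
    have "ereal ((\<delta> * real (Suc k) - C) / real (Suc k)) = ereal (\<delta> * real (Suc k) - C) / ereal (real (Suc k))" by simp
    also have "\<dots> \<le> ?o k" by (intro ereal_divide_right_mono lower) simp
    finally show "ereal ((\<delta> * real (Suc k) - C) / real (Suc k)) \<le> ?o k" .
  qed
  show "\<forall>\<^sub>F k in sequentially. ?o k \<le> ereal \<delta>"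
  proof (intro always_eventually allI)
    fix k
    have "?o k \<le> ereal (\<delta> * real (Suc k)) / ereal (real (Suc k))" by (intro ereal_divide_right_mono upper) simp
    also have "\<dots> = ereal \<delta>" by simp
    finally show "?o k \<le> ereal \<delta>" .
  qed
  have "(\<lambda>k. \<delta> - C * inverse (real (Suc k))) \<longlonglongrightarrow> \<delta> - C * 0"
    by (intro tendsto_intros LIMSEQ_inverse_real_of_nat)
  then have "(\<lambda>k. (\<delta> * real (Suc k) - C) / real (Suc k)) \<longlonglongrightarrow> \<delta>"
    by (simp add: diff_divide_distrib divide_inverse[of C])
  then show "(\<lambda>k. ereal ((\<delta> * real (Suc k) - C) / real (Suc k))) \<longlonglongrightarrow> ereal \<delta>" by simp
qed simp

lemma asym_ord_infinityI:
  assumes "\<And>k s. k \<ge> m \<Longrightarrow> a [^]\<^bsub>A\<^esub> (k::nat) \<in> ideal_pow A M s"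
  shows "asym_ord A M a = \<infinity>"
proof -
  have o: "ord_ideal A M (a [^]\<^bsub>A\<^esub> k) = \<infinity>" if "k \<ge> m" for k :: nat
  proof (rule ereal_top)
    fix B
    obtain s :: nat where "B \<le> real s" using real_arch_simple by blast
    then have "ereal B \<le> ereal (real s)" by simp
    also have "\<dots> \<le> ord_ideal A M (a [^]\<^bsub>A\<^esub> k)"
      unfolding ord_ideal_def using assms[OF that] by (intro SUP_upper) auto
    finally show "ereal B \<le> ord_ideal A M (a [^]\<^bsub>A\<^esub> k)" .
  qed
  have "\<forall>\<^sub>F k in sequentially. ord_ideal A M (a [^]\<^bsub>A\<^esub> Suc k) / ereal (real (Suc k)) = \<infinity>"
    using eventually_ge_at_top[of m] by eventually_elim (simp add: o del: Group.nat_pow_Suc monoid.nat_pow_Suc)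
  then show ?thesis unfolding asym_ord_def by (intro limI tendsto_eventually)
qed

section \<open>Comparison of the asymptotic order with the polyhedron\<close>

lemma (in hironaka_setting) asym_ord_y:
  assumes m: "m \<ge> 1"
  shows "asym_ord (R Quot (PIdl f)) (max_ideal (R Quot (PIdl f))) (PIdl f +>\<^bsub>R\<^esub> y)
    = delta_poly (length u) (hironaka_poly (length u) m S)"
proof (cases "\<exists>p\<in>S. snd p < m")
  case False
  \<comment> \<open>The polyhedron is empty and the class of \<open>y\<close> is nilpotent; both
    sides are infinite.\<close>
  then have no: "\<not> snd p < m" if "p \<in> S" for p using that by blast
  have "(PIdl f +>\<^bsub>R\<^esub> y) [^]\<^bsub>R Quot (PIdl f)\<^esub> k \<in> ideal_pow (R Quot (PIdl f)) (max_ideal (R Quot (PIdl f))) s"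
    if "m \<le> k" for k s :: nat
    using y_pow_mem_Rf_iff[OF m] y_pow_mem_PIdl[OF no that] by blast
  then have "asym_ord (R Quot (PIdl f)) (max_ideal (R Quot (PIdl f))) (PIdl f +>\<^bsub>R\<^esub> y) = \<infinity>"
    by (rule asym_ord_infinityI)
  also have "\<dots> = delta_poly (length u) (hironaka_poly (length u) m S)"
    using no by (intro delta_poly_empty[symmetric])
  finally show ?thesis .
next
  case True
  then obtain p1 where p1: "p1 \<in> S" "snd p1 < m"
    and min: "\<And>p. p \<in> S \<Longrightarrow> snd p < m \<Longrightarrow> slope d m p1 \<le> slope d m p"
  proof -
    define T where "T = {p \<in> S. snd p < m}"
    have "finite T" using finite_S unfolding T_def by simp
    moreover have "T \<noteq> {}" using True unfolding T_def by blast
    ultimately obtain b where b: "b \<in> slope d m ` T" "\<not> (\<exists>x\<in>slope d m ` T. x < b)"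
      using ex_min_if_finite[of "slope d m ` T"] by blast
    from b(1) obtain p1 where p1: "b = slope d m p1" "p1 \<in> T" by (rule imageE)
    show thesis
    proof (rule that)
      show "p1 \<in> S" "snd p1 < m" using p1(2) unfolding T_def by simp_all
      fix p assume "p \<in> S" "snd p < m"
      then have "slope d m p \<in> slope d m ` T" unfolding T_def by (intro imageI) simp
      then show "slope d m p1 \<le> slope d m p" using b(2) unfolding p1(1) by (blast intro: leI)
    qed
  qed
  define p q where "p = (\<Sum>j<d. fst p1 j)" and "q = m - snd p1"
  have q: "1 \<le> q" unfolding q_def using p1 by simp
  have pq: "q \<le> p" using order_le_degree[OF p1(1)] unfolding p_def q_def by simp
  have face: "q * (\<Sum>j<d. fst p1 j) + p * snd p1 \<le> p * m"
  proof -
    have "q * p + p * snd p1 = p * (q + snd p1)" by (simp add: algebra_simps)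
    then show ?thesis using p1(2) unfolding p_def[symmetric] q_def by simp
  qed
  \<comment> \<open>Minimality of the slope of \<open>p1\<close>, cleared of denominators: no
    monomial of \<open>f\<close> with \<open>y\<close>-degree below \<open>m\<close> is lighter than
    \<open>y [^] m\<close>.\<close>
  have supp: "p * m \<le> q * (\<Sum>j<d. fst r j) + p * snd r" if r: "r \<in> S" "snd r < m" for r
  proof -
    have "real p / real q \<le> real (\<Sum>j<d. fst r j) / real (m - snd r)"
      using min[OF r] unfolding slope_def p_def q_def .
    then have "real p * real (m - snd r) \<le> real q * real (\<Sum>j<d. fst r j)"
      using q r(2) by (simp add: field_simps)
    then have "p * (m - snd r) \<le> q * (\<Sum>j<d. fst r j)" by (simp only: of_nat_mult[symmetric] of_nat_le_iff)
    moreover have "p * m = p * (m - snd r) + p * snd r" using r(2) by (simp add: distrib_left[symmetric])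
    ultimately show ?thesis by simp
  qed
  have \<delta>: "slope d m p1 = real p / real q" unfolding slope_def p_def q_def ..
  have "asym_ord (R Quot (PIdl f)) (max_ideal (R Quot (PIdl f))) (PIdl f +>\<^bsub>R\<^esub> y) = ereal (real p / real q)"
  \<comment> \<open>The constant collects the slack \<open>p * (m - 1)\<close> of the division by
    \<open>f\<close>, divided by \<open>q\<close>, and \<open>1\<close> for the rounding in
    \<open>s\<close>.\<close>
  proof (rule asym_ord_eqI[where C = "real p * real (m - 1) / real q + 1"])
    fix k s :: nat
    assume "(PIdl f +>\<^bsub>R\<^esub> y) [^]\<^bsub>R Quot (PIdl f)\<^esub> k \<in> ideal_pow (R Quot (PIdl f)) (max_ideal (R Quot (PIdl f))) s"
    then have "q * s \<le> p * k"
      using y_pow_mem_bound[OF q pq p1 face] y_pow_mem_Rf_iff[OF m] by blast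
    then have "real q * real s \<le> real p * real k" by (simp only: of_nat_mult[symmetric] of_nat_le_iff)
    then show "real s \<le> real p / real q * real k" using q by (simp add: field_simps)
  next
    fix k :: nat
    \<comment> \<open>The largest \<open>s\<close> with
      \<open>q * s + p * (m - 1) \<le> p * k\<close>, if there is one; for smaller \<open>k\<close>
      truncated subtraction gives \<open>s = 0\<close>, where membership is trivial.\<close>
    define s where "s = (p * k - p * (m - 1)) div q"
    have mem: "(PIdl f +>\<^bsub>R\<^esub> y) [^]\<^bsub>R Quot (PIdl f)\<^esub> k \<in> ideal_pow (R Quot (PIdl f)) (max_ideal (R Quot (PIdl f))) s"
    proof (cases "p * (m - 1) \<le> p * k")
      case True
      have "q * s \<le> p * k - p * (m - 1)" unfolding s_def by simp
      then have "q * s + p * (m - 1) \<le> p * k" unfolding le_diff_conv2[OF True] .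
      then show ?thesis using y_pow_mem[OF q m supp] y_pow_mem_Rf_iff[OF m] by blast
    next
      case False
      then have "s = 0" unfolding s_def by simp
      moreover have "y [^] k \<in> carrier R <+>\<^bsub>R\<^esub> PIdl f"
        using ideal_add_cgenideal(2)[OF oneideal f_closed] by auto
      ultimately show ?thesis unfolding y_pow_mem_Rf_iff[OF m] by simp
    qed
    have "p * k - p * (m - 1) = q * s + (p * k - p * (m - 1)) mod q" unfolding s_def by simp
    moreover have "(p * k - p * (m - 1)) mod q < q" using q by simp
    ultimately have "p * k - p * (m - 1) < q * s + q" by linarith
    then have "p * k - p * (m - 1) < q * (s + 1)" by simp
    then have "p * k \<le> q * (s + 1) + p * (m - 1)" by linarith
    then have "real (p * k) \<le> real (q * (s + 1) + p * (m - 1))" by (simp only: of_nat_le_iff)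
    then have "real p * real k \<le> real q * (real s + 1) + real p * real (m - 1)"
      by (simp only: of_nat_add of_nat_mult of_nat_1)
    then have "real p / real q * real k - (real p * real (m - 1) / real q + 1) \<le> real s"
      using q by (simp add: field_simps)
    with mem show "\<exists>s. (PIdl f +>\<^bsub>R\<^esub> y) [^]\<^bsub>R Quot (PIdl f)\<^esub> k \<in> ideal_pow (R Quot (PIdl f)) (max_ideal (R Quot (PIdl f))) s \<and>
        real p / real q * real k - (real p * real (m - 1) / real q + 1) \<le> real s" by blast
  qed
  also have "\<dots> = delta_poly (length u) (hironaka_poly (length u) m S)"
    using delta_poly_eq_slope[OF p1 min] \<delta> by simp
  finally show ?thesis .
qed

theorem theorem8p2:
  fixes R :: "('a, 'b) ring_scheme" and n m :: nat and f y :: 'a and u :: "'a list"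
    and S :: "((nat \<Rightarrow> nat) \<times> nat) set" and c :: "(nat \<Rightarrow> nat) \<times> nat \<Rightarrow> 'a"
  assumes reg: "regular_local_ring R n"
    and f_carr: "f \<in> carrier R" and f_nonunit: "f \<notin> Units R"
    and ord_f: "ord_ideal R (max_ideal R) f = ereal (real m)" and m_gt: "m > 1"
    and extremal: "extremal_case (R Quot (PIdl\<^bsub>R\<^esub> f))"
    and rsp: "regular_system_of_parameters R n (u @ [y])"
    and initial: "f \<ominus>\<^bsub>R\<^esub> (y [^]\<^bsub>R\<^esub> m) \<in> ideal_pow R (max_ideal R) (Suc m)"
    and CP: "CP_expansion R u y f S c"
  shows "asym_ord (R Quot (PIdl\<^bsub>R\<^esub> f)) (max_ideal (R Quot (PIdl\<^bsub>R\<^esub> f)))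
           ((PIdl\<^bsub>R\<^esub> f) +>\<^bsub>R\<^esub> y)
         = delta_poly (length u) (hironaka_poly (length u) m S)"
proof -
  interpret regular_local R "max_ideal R" "u @ [y]"
    using regular_localI[OF rsp] by simp
  interpret hironaka_setting R "max_ideal R" u y f m S c
    by unfold_locales (use f_carr initial CP in auto)
  show ?thesis using asym_ord_y m_gt by simp
qed

end
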